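(* Let $\alpha\in(0,1]$. Then the function $$\varphi(\eta):=\alpha\,\gamma(\alpha;\eta),\qquad \eta\ge 0,$$ where $\gamma(\alpha;x)=\int_0^x e^{-w}w^{\alpha-1}\,dw$, is the Laplace exponent of a finite-activity (or step) subordinator $S_\alpha:=\{S_\alpha(t),t\ge 0\}$, with triplet $(0,0,\pi)$, where $\pi$ is an absolutely continuous Lévy measure, with completely monotone density $$\overline{\pi}(z)=\frac{1_{z\ge 1}\,\alpha (z-1)^{-\alpha}z^{-1}}{\Gamma(1-\alpha)}.$$
   Context: A subordinator is a Lévy process $S$ with non-decreasing paths; its Laplace exponent $\varphi$ is defined by $\mathbb{E}e^{-\eta S(t)}=e^{-t\varphi(\eta)}$. The Lévy triplet $(a,b,\nu)$ of a Bernstein function $\varphi$ is the one in the representation $\varphi(\eta)=a+b\eta+\int_0^{\infty}(1-e^{-s\eta})\,\nu(ds)$, with $a,b\ge 0$ and $\nu$ (the Lévy measure) a measure on $(0,\infty)$ with $\int_0^\infty (s\wedge 1)\,\nu(ds)<\infty$. Finite activity (step process) means that $a=b=0$ and $\nu((0,\infty))<\infty$. Absolute continuity and density are with respect to Lebesgue measure on $(0,\infty)$. A function $m$ on $(0,\infty)$ is completely monotone if it is $C^\infty$ and $(-1)^n m^{(n)}\ge 0$ for all $n\ge 0$.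
   Formalization: The absolute continuity and density claims are made only for α<1; at α=1 the Lévy measure is instead the Dirac mass at 1. Complete monotonicity of the density is claimed on (1,∞), not (0,∞), since the density vanishes on (0,1). *)

theory Defs
  imports "HOL-Probability.Probability"
begin

definition lower_gamma :: "real \<Rightarrow> real \<Rightarrow> real" where
  "lower_gamma a x = (LBINT w:{0..x}. exp (- w) * w powr (a - 1))"

definition cadlag :: "(real \<Rightarrow> real) \<Rightarrow> bool" where
  "cadlag f \<longleftrightarrow>
     (\<forall>t\<ge>0. continuous (at_right t) f) \<and> (\<forall>t>0. \<exists>l. (f \<longlongrightarrow> l) (at_left t))"

text \<open>Processes are indexed by \<open>real\<close>, but only times \<open>t \<ge> 0\<close> are ever constrained.
  Path properties are required almost surely.\<close>

definition levy_process :: "'w measure \<Rightarrow> (real \<Rightarrow> 'w \<Rightarrow> real) \<Rightarrow> bool" where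
  "levy_process M S \<longleftrightarrow>
     prob_space M \<and>
     (\<forall>t\<ge>0. S t \<in> borel_measurable M) \<and>
     (AE \<omega> in M. S 0 \<omega> = 0) \<and>
     (AE \<omega> in M. cadlag (\<lambda>t. S t \<omega>)) \<and>
     (\<forall>n (t :: nat \<Rightarrow> real). 0 \<le> t 0 \<longrightarrow> (\<forall>i<n. t i \<le> t (Suc i)) \<longrightarrow>
        prob_space.indep_vars M (\<lambda>_. borel)
          (\<lambda>i \<omega>. S (t (Suc i)) \<omega> - S (t i) \<omega>) {..<n}) \<and>
     (\<forall>s t. 0 \<le> s \<longrightarrow> s \<le> t \<longrightarrow>
        distr M borel (\<lambda>\<omega>. S t \<omega> - S s \<omega>) = distr M borel (S (t - s)))"

definition subordinator :: "'w measure \<Rightarrow> (real \<Rightarrow> 'w \<Rightarrow> real) \<Rightarrow> bool" where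
  "subordinator M S \<longleftrightarrow>
     levy_process M S \<and> (AE \<omega> in M. mono_on {0..} (\<lambda>t. S t \<omega>))"

definition has_laplace_exponent ::
    "'w measure \<Rightarrow> (real \<Rightarrow> 'w \<Rightarrow> real) \<Rightarrow> (real \<Rightarrow> real) \<Rightarrow> bool" where
  "has_laplace_exponent M S \<phi> \<longleftrightarrow>
     (\<forall>\<eta>\<ge>0. \<forall>t\<ge>0. (LINT \<omega>|M. exp (- \<eta> * S t \<omega>)) = exp (- t * \<phi> \<eta>))"

abbreviation lborel_pos :: "real measure" where
  "lborel_pos \<equiv> restrict_space lborel {0<..}"

definition levy_measure :: "real measure \<Rightarrow> bool" where
  "levy_measure \<nu> \<longleftrightarrow>
     sets \<nu> = sets lborel_pos \<and> (\<integral>\<^sup>+ s. ennreal (min s 1) \<partial>\<nu>) < \<infinity>"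

definition levy_triplet ::
    "(real \<Rightarrow> real) \<Rightarrow> real \<Rightarrow> real \<Rightarrow> real measure \<Rightarrow> bool" where
  "levy_triplet \<phi> a b \<nu> \<longleftrightarrow>
     0 \<le> a \<and> 0 \<le> b \<and> levy_measure \<nu> \<and>
     (\<forall>\<eta>\<ge>0. \<phi> \<eta> = a + b * \<eta> + (LINT s|\<nu>. 1 - exp (- s * \<eta>)))"

definition finite_activity :: "real \<Rightarrow> real \<Rightarrow> real measure \<Rightarrow> bool" where
  "finite_activity a b \<nu> \<longleftrightarrow> a = 0 \<and> b = 0 \<and> emeasure \<nu> {0<..} < \<infinity>"

text \<open>Complete monotonicity on the half-line \<open>(c, \<infinity>)\<close>; the usual notion is \<open>c = 0\<close>.
  Differentiability of every iterated derivative is smoothness.\<close>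

definition completely_monotone_beyond :: "real \<Rightarrow> (real \<Rightarrow> real) \<Rightarrow> bool" where
  "completely_monotone_beyond c m \<longleftrightarrow>
     (\<forall>n. \<forall>x>c. (deriv ^^ n) m differentiable (at x) \<and> (- 1) ^ n * (deriv ^^ n) m x \<ge> 0)"

definition phi :: "real \<Rightarrow> real \<Rightarrow> real" where
  "phi \<alpha> \<eta> = \<alpha> * lower_gamma \<alpha> \<eta>"

text \<open>At \<open>z = 1\<close> the term \<open>(z - 1) powr (- \<alpha>)\<close> is \<open>0\<close> rather than \<open>\<infinity>\<close>, which does not
  affect the measure. For \<open>\<alpha> = 1\<close> the value is identically \<open>0\<close>, as \<open>\<Gamma>\<close> has a pole at \<open>0\<close>,
  so the formula is meaningful as a density only for \<open>\<alpha> < 1\<close>. As \<open>\<alpha>\<close> increases to \<open>1\<close> the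
  measures with these densities converge weakly to the Dirac measure at \<open>1\<close>.\<close>

definition pi_density :: "real \<Rightarrow> real \<Rightarrow> real" where
  "pi_density \<alpha> z =
     indicator {1..} z * (\<alpha> * (z - 1) powr (- \<alpha>) * inverse z) / Gamma (1 - \<alpha>)"

end

theory Submission imports Defs begin

text \<open>Writing \<open>\<Gamma>(1-\<alpha>) w\<^sup>\<alpha>\<^sup>-\<^sup>1 e\<^sup>-\<^sup>w\<close> as the Laplace transform of \<open>(z-1)\<^sup>-\<^sup>\<alpha> 1\<^bsub>z\<ge>1\<^esub>\<close>
  at \<open>w\<close> and applying Tonelli over \<open>w \<in> [0, \<eta>]\<close> gives \<open>\<phi>(\<eta>) = \<integral> (1 - e\<^sup>-\<^sup>s\<^sup>\<eta>) \<pi>(ds)\<close>, and over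
  \<open>w \<ge> 0\<close> it gives the total mass \<open>\<alpha> \<Gamma>(\<alpha>)\<close> of \<open>\<pi>\<close>. As this mass is finite, the subordinator is a
  compound Poisson process, built here from iid exponential waiting times and iid jumps. Given
  \<open>n\<close> arrivals before time \<open>u\<close>, the sequence restarted at \<open>u\<close> is distributed as the original one
  and independent of the past, because exponential waiting times are memoryless; this yields
  independent and stationary increments.\<close>

subsection \<open>The compound Poisson process and its Markov property\<close>

text \<open>Prepending a coordinate with \<open>case_nat\<close> preserves measure, which is checked
  on cylinders; Tonelli then separates the first coordinate. The factors may differ, since waiting
  times and jumps will alternate.\<close>

lemma nn_integral_PiM_case_nat:
  fixes K :: "nat \<Rightarrow> 'a measure"
  assumes K: "\<And>i. prob_space (K i)" and F[measurable]: "F \<in> borel_measurable (PiM UNIV K)"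
  shows "(\<integral>\<^sup>+\<omega>. F \<omega> \<partial>PiM UNIV K) =
    (\<integral>\<^sup>+x. \<integral>\<^sup>+\<omega>. F (case_nat x \<omega>) \<partial>PiM UNIV (\<lambda>i. K (Suc i)) \<partial>K 0)"
proof -
  let ?S = "PiM UNIV (\<lambda>i. K (Suc i))"
  let ?f = "\<lambda>(x, \<omega>). case_nat x \<omega>"
  interpret K: product_prob_space K UNIV
    by (simp add: K product_prob_spaceI)
  interpret S: product_prob_space "\<lambda>i. K (Suc i)" UNIV
    by (simp add: K product_prob_spaceI)
  have [measurable]: "?f \<in> measurable (K 0 \<Otimes>\<^sub>M ?S) (PiM UNIV K)"
  proof (rule measurable_PiM_single')
    fix i :: nat
    show "(\<lambda>p. (case p of (x, \<omega>) \<Rightarrow> case_nat x \<omega>) i) \<in> measurable (K 0 \<Otimes>\<^sub>M ?S) (K i)"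
      by (cases i) (simp_all add: split_beta')
  qed (auto simp: space_pair_measure space_PiM PiE_iff split: nat.split)
  have "distr (K 0 \<Otimes>\<^sub>M ?S) (PiM UNIV K) ?f = PiM UNIV K"
  proof (rule K.PiM_eq)
    fix J E assume J: "finite J" "J \<subseteq> UNIV" "\<And>j. j \<in> J \<Longrightarrow> E j \<in> sets (K j)"
    let ?X = "prod_emb UNIV K J (\<Pi>\<^sub>E j\<in>J. E j)"
    have *: "\<And>j x. j \<in> J \<Longrightarrow> x \<in> E j \<Longrightarrow> x \<in> space (K j)"
      using J(3)[THEN sets.sets_into_space] by (auto simp: subset_eq)
    \<comment> \<open>The preimage of a cylinder is a rectangle: \<open>?E\<close> is the constraint
      on coordinate 0, vacuous if 0 is not in \<open>J\<close>, and \<open>?F\<close> carries the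
      others, shifted down by one.\<close>
    let ?E = "if 0 \<in> J then E 0 else space (K 0)"
    let ?F = "prod_emb UNIV (\<lambda>i. K (Suc i)) (Suc -` J) (\<Pi>\<^sub>E j\<in>Suc -` J. E (Suc j))"
    have "?f -` ?X \<inter> space (K 0 \<Otimes>\<^sub>M ?S) = ?E \<times> ?F"
      using * by (auto simp: space_pair_measure space_PiM PiE_iff prod_emb_def all_conj_distrib
          split: nat.split nat.split_asm)
    moreover have X: "?X \<in> sets (PiM UNIV K)"
      using J by (intro sets_PiM_I) auto
    ultimately have "emeasure (distr (K 0 \<Otimes>\<^sub>M ?S) (PiM UNIV K) ?f) ?X = emeasure (K 0 \<Otimes>\<^sub>M ?S) (?E \<times> ?F)"
      by (subst emeasure_distr) auto
    also have "\<dots> = emeasure (K 0) ?E * emeasure ?S ?F"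
      using J by (intro S.P.emeasure_pair_measure_Times) (auto intro!: sets_PiM_I finite_vimageI)
    also have "emeasure ?S ?F = (\<Prod>j\<in>Suc -` J. emeasure (K (Suc j)) (E (Suc j)))"
      using J by (intro S.emeasure_PiM_emb) (simp_all add: finite_vimageI)
    also have "\<dots> = (\<Prod>j\<in>J - {0}. emeasure (K j) (E j))"
      by (rule prod.reindex_bij_witness[of _ "\<lambda>j. j - 1" Suc]) auto
    also have "emeasure (K 0) ?E * (\<Prod>j\<in>J - {0}. emeasure (K j) (E j)) = (\<Prod>j\<in>J. emeasure (K j) (E j))"
      by (auto simp: K.M.emeasure_space_1 prod.remove J)
    finally show "emeasure (distr (K 0 \<Otimes>\<^sub>M ?S) (PiM UNIV K) ?f) ?X = (\<Prod>j\<in>J. emeasure (K j) (E j))" .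
  qed simp
  then have "(\<integral>\<^sup>+\<omega>. F \<omega> \<partial>PiM UNIV K) = (\<integral>\<^sup>+\<omega>. F \<omega> \<partial>distr (K 0 \<Otimes>\<^sub>M ?S) (PiM UNIV K) ?f)"
    by simp
  also have "\<dots> = (\<integral>\<^sup>+p. F (?f p) \<partial>(K 0 \<Otimes>\<^sub>M ?S))"
    by (rule nn_integral_distr) simp_all
  also have "\<dots> = (\<integral>\<^sup>+x. \<integral>\<^sup>+\<omega>. F (?f (x, \<omega>)) \<partial>?S \<partial>K 0)"
    by (rule S.P.nn_integral_fst[symmetric]) measurable
  finally show ?thesis by simp
qed

section \<open>Sequences of waiting times and jumps\<close>

locale compound_poisson =
  fixes l :: real and \<mu> :: "real measure"
  assumes rate_pos: "0 < l"
    and prob_space_jump: "prob_space \<mu>"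
    and sets_jump[measurable_cong]: "sets \<mu> = sets borel"
    and jump_nonneg: "AE y in \<mu>. 0 \<le> y"
begin

definition wait :: "real measure" where
  "wait = density lborel (exponential_density l)"

text \<open>Waiting times sit at the even indices, jump sizes at the odd ones.\<close>

definition marked_times :: "(nat \<Rightarrow> real) measure" where
  "marked_times = PiM UNIV (\<lambda>i. if even i then wait else \<mu>)"

definition arrival :: "nat \<Rightarrow> (nat \<Rightarrow> real) \<Rightarrow> real" where
  "arrival n \<omega> = (\<Sum>i<n. \<omega> (2 * i))"

definition jump_sum :: "nat \<Rightarrow> (nat \<Rightarrow> real) \<Rightarrow> real" where
  "jump_sum n \<omega> = (\<Sum>i<n. \<omega> (2 * i + 1))"

text \<open>If arrivals do not accumulate, only finitely many terms are nonzero. Elsewhere the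
  series takes some default value, which only matters on a null set, and measurability needs no case
  distinction.\<close>

definition cpp :: "real \<Rightarrow> (nat \<Rightarrow> real) \<Rightarrow> real" where
  "cpp t \<omega> = (\<Sum>k. if arrival (Suc k) \<omega> \<le> t then \<omega> (2 * k + 1) else 0)"

text \<open>The marked sequence as seen from time \<open>u\<close> after \<open>n\<close> arrivals:
  the first waiting time becomes the residual time to the next arrival, and every later entry is
  shifted past the \<open>n\<close> used pairs.\<close>

definition restart :: "real \<Rightarrow> nat \<Rightarrow> (nat \<Rightarrow> real) \<Rightarrow> nat \<Rightarrow> real" where
  "restart u n \<omega> = (\<lambda>i. if i = 0 then arrival (Suc n) \<omega> - u else \<omega> (2 * n + i))"

text \<open>The Poisson probability of \<open>n\<close> arrivals by time \<open>u\<close>. The value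
  0 at negative times makes the recursion \<open>pois_Suc\<close> a plain convolution over all
  waiting times.\<close>

definition pois :: "real \<Rightarrow> nat \<Rightarrow> real" where
  "pois u n = (if u < 0 then 0 else (l * u) ^ n / fact n * exp (- l * u))"

lemma sets_wait[measurable_cong]: "sets wait = sets borel"
  by (simp add: wait_def)

lemma prob_space_wait: "prob_space wait"
  unfolding wait_def using prob_space_exponential_density[OF rate_pos] .

lemma sets_marked_times[measurable_cong]: "sets marked_times = sets (PiM UNIV (\<lambda>_. borel))"
  unfolding marked_times_def by (intro sets_PiM_cong) (auto simp: sets_wait sets_jump)

lemma space_marked_times[simp]: "space marked_times = UNIV"
  using sets_eq_imp_space_eq[OF sets_marked_times] by (simp add: space_PiM)

lemma prob_space_marked_times: "prob_space marked_times"
  unfolding marked_times_def by (intro prob_space_PiM) (auto simp: prob_space_wait prob_space_jump)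

sublocale prob_space marked_times by (rule prob_space_marked_times)

sublocale W: prob_space wait by (rule prob_space_wait)

sublocale J: prob_space \<mu> by (rule prob_space_jump)

lemma measurable_arrival[measurable]: "arrival n \<in> borel_measurable (PiM UNIV (\<lambda>_. borel))"
  unfolding arrival_def by measurable

lemma measurable_jump_sum[measurable]: "jump_sum n \<in> borel_measurable (PiM UNIV (\<lambda>_. borel))"
  unfolding jump_sum_def by measurable

lemma measurable_cpp[measurable]: "cpp t \<in> borel_measurable (PiM UNIV (\<lambda>_. borel))"
  unfolding cpp_def by measurable

lemma measurable_restart[measurable]: "restart u n \<in> measurable (PiM UNIV (\<lambda>_. borel)) (PiM UNIV (\<lambda>_. borel))"
  unfolding restart_def
  by (rule measurable_PiM_single') (auto simp: space_PiM)

text \<open>Lets the measurability prover handle the nested integrals over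
  \<open>case_nat t (case_nat y \<omega>)\<close>.\<close>

lemma measurable_cons[measurable (raw)]:
  fixes f :: "'a \<Rightarrow> real"
  assumes [measurable]: "f \<in> borel_measurable N" "g \<in> measurable N (PiM UNIV (\<lambda>_. borel))"
  shows "(\<lambda>x. case_nat (f x) (g x)) \<in> measurable N (PiM UNIV (\<lambda>_::nat. borel))"
proof (rule measurable_PiM_single')
  show "(\<lambda>x. case_nat (f x) (g x) i) \<in> borel_measurable N" for i
    by (cases i) simp_all
qed (auto simp: space_PiM)

text \<open>Two coordinates are split off at once: a shift by two keeps parity, so the tail again
  has the law \<open>marked_times\<close>. This is the renewal step behind the inductions on the
  number of arrivals.\<close>

lemma nn_integral_marked_times:
  assumes F[measurable]: "F \<in> borel_measurable (PiM UNIV (\<lambda>_. borel))"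
  shows "(\<integral>\<^sup>+\<omega>. F \<omega> \<partial>marked_times) =
    (\<integral>\<^sup>+t. \<integral>\<^sup>+y. \<integral>\<^sup>+\<omega>. F (case_nat t (case_nat y \<omega>)) \<partial>marked_times \<partial>\<mu> \<partial>wait)"
proof -
  define K where "K i = (if even i then wait else \<mu>)" for i :: nat
  have K: "prob_space (K i)" for i by (simp add: K_def prob_space_wait prob_space_jump)
  have sets_K: "sets (K i) = sets borel" for i by (simp add: K_def sets_wait sets_jump)
  have S: "sets (PiM UNIV K) = sets (PiM UNIV (\<lambda>_. borel))"
    "sets (PiM UNIV (\<lambda>i. K (Suc i))) = sets (PiM UNIV (\<lambda>_. borel))"
    by (simp_all add: sets_K cong: sets_PiM_cong)
  have K_shift: "(\<lambda>i. K (Suc (Suc i))) = K" by (auto simp: K_def)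
  have M: "marked_times = PiM UNIV K" by (simp add: marked_times_def K_def[abs_def])
  have "(\<integral>\<^sup>+\<omega>. F \<omega> \<partial>PiM UNIV K) =
    (\<integral>\<^sup>+t. \<integral>\<^sup>+\<omega>. F (case_nat t \<omega>) \<partial>PiM UNIV (\<lambda>i. K (Suc i)) \<partial>K 0)"
    by (rule nn_integral_PiM_case_nat[OF K]) (simp add: measurable_cong_sets[OF S(1) refl])
  also have "\<dots> = (\<integral>\<^sup>+t. \<integral>\<^sup>+y. \<integral>\<^sup>+\<omega>. F (case_nat t (case_nat y \<omega>)) \<partial>PiM UNIV K \<partial>K (Suc 0) \<partial>K 0)"
    by (subst nn_integral_PiM_case_nat[of "\<lambda>i. K (Suc i)"])
      (use K in \<open>simp_all add: K_shift measurable_cong_sets[OF S(2) refl]\<close>)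
  finally show ?thesis by (simp add: M K_def)
qed

lemma arrival_0[simp]: "arrival 0 \<omega> = 0"
  by (simp add: arrival_def)

lemma arrival_Suc: "arrival (Suc n) \<omega> = arrival n \<omega> + \<omega> (2 * n)"
  by (simp add: arrival_def)

lemma arrival_cons: "arrival (Suc n) (case_nat t (case_nat y \<omega>)) = t + arrival n \<omega>"
  unfolding arrival_def by (subst sum.lessThan_Suc_shift) simp

lemma jump_sum_0[simp]: "jump_sum 0 \<omega> = 0"
  by (simp add: jump_sum_def)

lemma jump_sum_cons: "jump_sum (Suc n) (case_nat t (case_nat y \<omega>)) = y + jump_sum n \<omega>"
  unfolding jump_sum_def by (subst sum.lessThan_Suc_shift) simp

text \<open>Once the first arrival \<open>t\<close> is removed, the clock of the tail reads
  \<open>u - t\<close>; this recursion drives the induction in \<open>markov_count\<close>.\<close>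

lemma restart_cons: "restart u (Suc n) (case_nat t (case_nat y \<omega>)) = restart (u - t) n \<omega>"
  by (auto simp: restart_def arrival_cons fun_eq_iff split: nat.split)

lemma restart_0_cons: "restart u 0 (case_nat t (case_nat y \<omega>)) = case_nat (t - u) (case_nat y \<omega>)"
  by (auto simp: restart_def fun_eq_iff arrival_def split: nat.split)

text \<open>Restricted to positive indices: \<open>arrival 0\<close> of the restarted sequence is 0
  and not \<open>arrival n \<omega> - u\<close>.\<close>

lemma arrival_restart: "arrival (Suc k) (restart u n \<omega>) = arrival (Suc (k + n)) \<omega> - u"
proof (induction k)
  case 0
  then show ?case by (simp add: arrival_def restart_def)
next
  case (Suc k)
  have "2 * n + 2 * Suc k = 2 * (Suc k + n)" by simp
  with Suc show ?case
    by (simp add: arrival_Suc[of "Suc k"] arrival_Suc[of "Suc (k + n)"] restart_def del: mult_Suc_right)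
qed

section \<open>Memoryless waiting times and Poisson weights\<close>

lemma nn_integral_wait:
  assumes [measurable]: "F \<in> borel_measurable borel"
  shows "(\<integral>\<^sup>+t. F t \<partial>wait) = (\<integral>\<^sup>+t. ennreal (exponential_density l t) * F t \<partial>lborel)"
  unfolding wait_def by (rule nn_integral_density) simp_all

text \<open>After the substitution \<open>t = u + s\<close> the exponential density splits off the
  factor \<open>exp (- l * u)\<close>.\<close>

lemma wait_memoryless:
  assumes [measurable]: "F \<in> borel_measurable borel" and u: "0 \<le> u"
  shows "(\<integral>\<^sup>+t. (if u < t then F (t - u) else 0) \<partial>wait) = ennreal (exp (- l * u)) * (\<integral>\<^sup>+t. F t \<partial>wait)"
proof -
  have "(\<integral>\<^sup>+t. (if u < t then F (t - u) else 0) \<partial>wait) =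
    (\<integral>\<^sup>+t. ennreal (exponential_density l t) * (if u < t then F (t - u) else 0) \<partial>lborel)"
    by (rule nn_integral_wait) measurable
  also have "\<dots> = (\<integral>\<^sup>+s. ennreal (exponential_density l (u + s)) * (if 0 < s then F s else 0) \<partial>lborel)"
    by (subst nn_integral_real_affine[where t=u and c=1]) (simp_all cong: if_cong)
  also have "\<dots> = (\<integral>\<^sup>+s. ennreal (exp (- l * u)) * (ennreal (exponential_density l s) * F s) \<partial>lborel)"
  proof (rule nn_integral_cong_AE)
    have eq: "exponential_density l (u + s) = exp (- l * u) * exponential_density l s" if "0 < s" for s
      using that u by (simp add: exponential_density_def algebra_simps exp_add[symmetric])
    \<comment> \<open>The point \<open>s = 0\<close> has to be left out: the strict inequality makes
      the left side vanish there, while the density on the right is \<open>l\<close>.\<close>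
    show "AE s in lborel. ennreal (exponential_density l (u + s)) * (if 0 < s then F s else 0) =
        ennreal (exp (- l * u)) * (ennreal (exponential_density l s) * F s)"
      using AE_lborel_singleton[of 0]
    proof eventually_elim
      case (elim s)
      show ?case
      proof (cases "0 < s")
        case True
        then show ?thesis
          using rate_pos by (simp only: eq) (simp add: ennreal_mult mult.assoc)
      next
        case False
        then have "s < 0" using elim by simp
        then show ?thesis by (simp add: exponential_density_def)
      qed
    qed
  qed
  also have "\<dots> = ennreal (exp (- l * u)) * (\<integral>\<^sup>+s. ennreal (exponential_density l s) * F s \<partial>lborel)"
    by (rule nn_integral_cmult) measurable
  finally show ?thesis by (simp add: nn_integral_wait)
qed

lemma measurable_pois[measurable]: "(\<lambda>u. pois u n) \<in> borel_measurable borel"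
  unfolding pois_def by measurable

lemma pois_nonneg: "0 \<le> pois u n"
  using rate_pos by (simp add: pois_def)

text \<open>The exponentials \<open>exp (- l * t)\<close> and \<open>exp (- l * (u - t))\<close>
  multiply to a constant in \<open>t\<close>, so for \<open>u \<ge> 0\<close> only the power
  \<open>(u - t) ^ n\<close> is integrated over \<open>{0..u}\<close>.\<close>

lemma pois_Suc: "(\<integral>\<^sup>+t. ennreal (pois (u - t) n) \<partial>wait) = ennreal (pois u (Suc n))"
proof (cases "u < 0")
  case True
  have "(\<integral>\<^sup>+t. ennreal (pois (u - t) n) \<partial>wait) =
      (\<integral>\<^sup>+t. ennreal (exponential_density l t) * ennreal (pois (u - t) n) \<partial>lborel)"
    by (rule nn_integral_wait) measurable
  also have "\<dots> = (\<integral>\<^sup>+(t::real). 0 \<partial>lborel)"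
    using True by (intro nn_integral_cong) (auto simp: exponential_density_def pois_def)
  finally show ?thesis using True by (simp add: pois_def)
next
  case False
  define C where "C = l ^ Suc n * exp (- l * u) / fact n"
  have C: "0 \<le> C" using rate_pos by (simp add: C_def)
  have density: "exponential_density l t * pois (u - t) n = C * (u - t) ^ n" if "t \<in> {0..u}" for t
  proof -
    have "exp (- t * l) * exp (- l * (u - t)) = exp (- l * u)"
      by (simp add: exp_add[symmetric] algebra_simps)
    moreover have "exponential_density l t * pois (u - t) n =
        l ^ Suc n * (u - t) ^ n / fact n * (exp (- t * l) * exp (- l * (u - t)))"
      using that by (simp add: exponential_density_def pois_def power_mult_distrib)
    ultimately show ?thesis by (simp add: C_def)
  qed
  have "(\<integral>\<^sup>+t. ennreal (pois (u - t) n) \<partial>wait) =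
      (\<integral>\<^sup>+t. ennreal (exponential_density l t) * ennreal (pois (u - t) n) \<partial>lborel)"
    by (rule nn_integral_wait) measurable
  also have "\<dots> = (\<integral>\<^sup>+t. ennreal (C * (u - t) ^ n) * indicator {0..u} t \<partial>lborel)"
  proof (rule nn_integral_cong)
    fix t
    show "ennreal (exponential_density l t) * ennreal (pois (u - t) n) =
        ennreal (C * (u - t) ^ n) * indicator {0..u} t"
    proof (cases "t \<in> {0..u}")
      case True
      then show ?thesis
        using density[OF True] pois_nonneg[of "u - t" n] rate_pos by (simp add: ennreal_mult'[symmetric])
    next
      case False
      then show ?thesis by (auto simp: exponential_density_def pois_def)
    qed
  qed
  also have "\<dots> = ennreal (- C / real (Suc n) * (u - u) ^ Suc n - (- C / real (Suc n) * (u - 0) ^ Suc n))"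
  proof (rule nn_integral_FTC_Icc)
    show "((\<lambda>t. - C / real (Suc n) * (u - t) ^ Suc n) has_real_derivative C * (u - t) ^ n) (at t)" for t
      by (auto intro!: derivative_eq_intros simp del: power_Suc of_nat_Suc)
  qed (use False C in auto)
  also have "- C / real (Suc n) * (u - u) ^ Suc n - (- C / real (Suc n) * (u - 0) ^ Suc n) = pois u (Suc n)"
    using False by (simp add: C_def pois_def power_mult_distrib mult_ac)
  finally show ?thesis .
qed

lemma nn_integral_jump_sum_Suc:
  assumes [measurable]: "f \<in> borel_measurable borel"
  shows "(\<integral>\<^sup>+\<omega>. f (jump_sum (Suc n) \<omega>) \<partial>marked_times) =
    (\<integral>\<^sup>+y. \<integral>\<^sup>+\<omega>. f (y + jump_sum n \<omega>) \<partial>marked_times \<partial>\<mu>)"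
  by (subst nn_integral_marked_times) (simp_all add: jump_sum_cons W.emeasure_space_1)

text \<open>The statement holds for every real \<open>u\<close> (both sides vanish for \<open>u < 0\<close>), which allows an
  induction on \<open>n\<close> that conditions on the first arrival \<open>t\<close> without comparing \<open>t\<close> to \<open>u\<close>.\<close>

lemma markov_count:
  assumes G[measurable]: "G \<in> borel_measurable (PiM UNIV (\<lambda>_. borel))"
    and "f \<in> borel_measurable borel"
  shows "(\<integral>\<^sup>+\<omega>. (if arrival n \<omega> \<le> u \<and> u < arrival (Suc n) \<omega>
        then f (jump_sum n \<omega>) * G (restart u n \<omega>) else 0) \<partial>marked_times) =
    ennreal (pois u n) * (\<integral>\<^sup>+\<omega>. f (jump_sum n \<omega>) \<partial>marked_times) * (\<integral>\<^sup>+\<omega>. G \<omega> \<partial>marked_times)"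
  using assms(2)
proof (induction n arbitrary: u f)
  case 0
  note [measurable] = 0
  have "(\<integral>\<^sup>+\<omega>. (if arrival 0 \<omega> \<le> u \<and> u < arrival (Suc 0) \<omega>
        then f (jump_sum 0 \<omega>) * G (restart u 0 \<omega>) else 0) \<partial>marked_times) =
     (\<integral>\<^sup>+t. \<integral>\<^sup>+y. \<integral>\<^sup>+\<omega>. (if 0 \<le> u \<and> u < t then f 0 * G (case_nat (t - u) (case_nat y \<omega>)) else 0)
       \<partial>marked_times \<partial>\<mu> \<partial>wait)"
    by (subst nn_integral_marked_times) (simp_all add: arrival_cons restart_0_cons cong: if_cong)
  \<comment> \<open>No arrival by \<open>u\<close> means that the first wait exceeds
    \<open>u\<close>; by \<open>wait_memoryless\<close> the residual \<open>t - u\<close> then acts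
    as a fresh first wait.\<close>
  also have "\<dots> = (\<integral>\<^sup>+t. (if u < t then (if 0 \<le> u then f 0 else 0) *
      (\<integral>\<^sup>+y. \<integral>\<^sup>+\<omega>. G (case_nat (t - u) (case_nat y \<omega>)) \<partial>marked_times \<partial>\<mu>) else 0) \<partial>wait)"
    by (rule nn_integral_cong) (simp add: nn_integral_cmult)
  also have "\<dots> = ennreal (pois u 0) * f 0 *
      (\<integral>\<^sup>+t. \<integral>\<^sup>+y. \<integral>\<^sup>+\<omega>. G (case_nat t (case_nat y \<omega>)) \<partial>marked_times \<partial>\<mu> \<partial>wait)" (is "?L = _")
  proof (cases "0 \<le> u")
    case True
    then show ?thesis
      by (simp add: wait_memoryless[of "\<lambda>t. f 0 * (\<integral>\<^sup>+y. \<integral>\<^sup>+\<omega>. G (case_nat t (case_nat y \<omega>)) \<partial>marked_times \<partial>\<mu>)"]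
          nn_integral_cmult pois_def mult.assoc)
  next
    case False
    then have "?L = (\<integral>\<^sup>+t. 0 \<partial>wait)" by (intro nn_integral_cong) simp
    with False show ?thesis by (simp add: pois_def)
  qed
  finally show ?case
    by (simp add: nn_integral_marked_times[symmetric] emeasure_space_1[simplified])
next
  case (Suc n)
  note [measurable] = Suc.prems
  have "(\<integral>\<^sup>+\<omega>. (if arrival (Suc n) \<omega> \<le> u \<and> u < arrival (Suc (Suc n)) \<omega>
        then f (jump_sum (Suc n) \<omega>) * G (restart u (Suc n) \<omega>) else 0) \<partial>marked_times) =
     (\<integral>\<^sup>+t. \<integral>\<^sup>+y. \<integral>\<^sup>+\<omega>. (if arrival n \<omega> \<le> u - t \<and> u - t < arrival (Suc n) \<omega>
        then f (y + jump_sum n \<omega>) * G (restart (u - t) n \<omega>) else 0)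
       \<partial>marked_times \<partial>\<mu> \<partial>wait)"
    by (subst nn_integral_marked_times)
      (auto simp: arrival_cons restart_cons jump_sum_cons algebra_simps intro!: nn_integral_cong)
  also have "\<dots> = (\<integral>\<^sup>+t. \<integral>\<^sup>+y. ennreal (pois (u - t) n) *
      (\<integral>\<^sup>+\<omega>. f (y + jump_sum n \<omega>) \<partial>marked_times) * (\<integral>\<^sup>+\<omega>. G \<omega> \<partial>marked_times) \<partial>\<mu> \<partial>wait)"
    \<comment> \<open>The hypothesis is used at time \<open>u - t\<close> and for the translate of
      \<open>f\<close> by the first jump \<open>y\<close>, so both \<open>u\<close> and
      \<open>f\<close> must vary in the induction.\<close>
    by (subst Suc.IH) simp_all
  also have "\<dots> = (\<integral>\<^sup>+t. ennreal (pois (u - t) n) \<partial>wait) *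
      (\<integral>\<^sup>+y. \<integral>\<^sup>+\<omega>. f (y + jump_sum n \<omega>) \<partial>marked_times \<partial>\<mu>) * (\<integral>\<^sup>+\<omega>. G \<omega> \<partial>marked_times)"
    by (simp add: nn_integral_multc nn_integral_cmult)
  finally show ?case by (simp add: pois_Suc nn_integral_jump_sum_Suc)
qed

end

subsection \<open>Regular paths and increments\<close>

lemma step_continuous_right:
  fixes a t y :: real
  shows "continuous (at_right t) (\<lambda>s. if a \<le> s then y else 0)"
proof (cases "a \<le> t")
  case True
  have "\<forall>\<^sub>F s in at_right t. (if a \<le> s then y else 0) = y"
    using eventually_at_right_less[of t] by eventually_elim (use True in auto)
  then show ?thesis using True by (simp add: continuous_within tendsto_eventually)
next
  case False
  have "\<forall>\<^sub>F s in at_right t. (if a \<le> s then y else 0) = 0"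
    by (rule eventually_at_rightI[of t a]) (use False in auto)
  then show ?thesis using False by (simp add: continuous_within tendsto_eventually)
qed

text \<open>The comparison turns strict in the limit: a jump exactly at \<open>t\<close> is not yet
  seen from the left.\<close>

lemma step_left_limit:
  fixes a t y :: real
  shows "((\<lambda>s. if a \<le> s then y else 0) \<longlongrightarrow> (if a < t then y else 0)) (at_left t)"
proof (cases "a < t")
  case True
  have "\<forall>\<^sub>F s in at_left t. (if a \<le> s then y else 0) = y"
    by (rule eventually_at_leftI[of a t]) (use True in auto)
  then show ?thesis using True by (simp add: tendsto_eventually)
next
  case False
  have "\<forall>\<^sub>F s in at_left t. (if a \<le> s then y else 0) = 0"
    by (rule eventually_at_leftI[of "t - 1" t]) (use False in auto)
  then show ?thesis using False by (simp add: tendsto_eventually)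
qed

section \<open>Almost sure regularity of the marked sequences\<close>

context compound_poisson begin

text \<open>The event on which all path properties are proved: nonnegative entries make arrivals and
  paths monotone, and unbounded arrivals leave finitely many jumps before each time.\<close>

definition regular :: "(nat \<Rightarrow> real) \<Rightarrow> bool" where
  "regular \<omega> \<longleftrightarrow> (\<forall>i. 0 \<le> \<omega> i) \<and> (\<forall>t. \<exists>n. t < arrival n \<omega>)"

lemma arrival_mono:
  assumes "\<forall>i. 0 \<le> \<omega> i" "m \<le> n"
  shows "arrival m \<omega> \<le> arrival n \<omega>"
  unfolding arrival_def using assms by (intro sum_mono2) auto

lemma arrivals_unique:
  assumes "\<forall>i. 0 \<le> \<omega> i"
    and "arrival m \<omega> \<le> u" "u < arrival (Suc m) \<omega>"
    and "arrival n \<omega> \<le> u" "u < arrival (Suc n) \<omega>"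
  shows "m = n"
proof (cases m n rule: linorder_cases)
  case less
  then show ?thesis using arrival_mono[OF assms(1), of "Suc m" n] assms(3,4) by simp
next
  case greater
  then show ?thesis using arrival_mono[OF assms(1), of "Suc n" m] assms(2,5) by simp
qed

text \<open>Exactly one number of arrivals by time \<open>u\<close> is realised, so the series has a
  single active term. This splits expectations according to the count.\<close>

lemma suminf_arrivals:
  fixes h :: "nat \<Rightarrow> ennreal"
  assumes "\<forall>i. 0 \<le> \<omega> i" "arrival n \<omega> \<le> u" "u < arrival (Suc n) \<omega>"
  shows "(\<Sum>m. if arrival m \<omega> \<le> u \<and> u < arrival (Suc m) \<omega> then h m else 0) = h n"
proof -
  have "(if arrival m \<omega> \<le> u \<and> u < arrival (Suc m) \<omega> then h m else 0) = (if m = n then h m else 0)" for m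
  proof (cases "m = n")
    case False
    then have "\<not> (arrival m \<omega> \<le> u \<and> u < arrival (Suc m) \<omega>)"
      using arrivals_unique[OF assms(1) _ _ assms(2,3), of m] by blast
    with False show ?thesis by (simp only: if_False simp_thms)
  qed (use assms(2,3) in simp)
  then show ?thesis
    by (simp only: sums_unique[OF sums_single[of n h], symmetric])
qed

text \<open>The Poisson generating function, from the exponential series. At \<open>c = 1\<close> it
  gives total mass 1, and at the Laplace transform of a jump it gives the Laplace exponent.\<close>

lemma suminf_pois:
  assumes "0 \<le> u" "0 \<le> c"
  shows "(\<Sum>n. ennreal (pois u n * c ^ n)) = ennreal (exp (- l * u * (1 - c)))"
proof -
  have "(\<lambda>n. exp (- l * u) * ((l * u * c) ^ n /\<^sub>R fact n)) sums (exp (- l * u) * exp (l * u * c))"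
    by (intro sums_mult exp_converges)
  moreover have "exp (- l * u) * ((l * u * c) ^ n /\<^sub>R fact n) = pois u n * c ^ n" for n
    using assms by (simp add: pois_def power_mult_distrib divide_inverse mult_ac)
  moreover have "exp (- l * u) * exp (l * u * c) = exp (- l * u * (1 - c))"
    by (simp add: exp_add[symmetric] algebra_simps)
  ultimately have "(\<lambda>n. pois u n * c ^ n) sums exp (- l * u * (1 - c))"
    by simp
  then show ?thesis
    using assms pois_nonneg by (simp add: sums_iff suminf_ennreal2)
qed

lemma AE_nonneg: "AE \<omega> in marked_times. \<forall>i. 0 \<le> \<omega> i"
proof -
  have wait: "AE t in wait. 0 \<le> t"
    unfolding wait_def by (subst AE_density) (auto simp: exponential_density_def)
  have "AE \<omega> in marked_times. 0 \<le> \<omega> i" for i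
    unfolding marked_times_def
    by (rule AE_PiM_component[where P="\<lambda>x. 0 \<le> x"])
      (auto simp: prob_space_wait prob_space_jump wait jump_nonneg)
  then show ?thesis by (simp add: AE_all_countable)
qed

text \<open>No law of large numbers is needed: the Poisson weights sum to 1, so almost surely some
  number of arrivals occurs before each time.\<close>

lemma AE_regular: "AE \<omega> in marked_times. regular \<omega>"
proof -
  have "AE \<omega> in marked_times. \<exists>n. arrival n \<omega> \<le> u \<and> u < arrival (Suc n) \<omega>" if u: "0 \<le> u" for u
  proof -
    let ?B = "{\<omega> \<in> space marked_times. \<exists>n. arrival n \<omega> \<le> u \<and> u < arrival (Suc n) \<omega>}"
    have B: "?B \<in> events" by measurable
    have "emeasure marked_times ?B = (\<integral>\<^sup>+\<omega>. indicator ?B \<omega> \<partial>marked_times)"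
      by (rule nn_integral_indicator[OF B, symmetric])
    also have "\<dots> = (\<integral>\<^sup>+\<omega>. (\<Sum>n. if arrival n \<omega> \<le> u \<and> u < arrival (Suc n) \<omega> then 1 else 0) \<partial>marked_times)"
      using AE_nonneg
    proof (intro nn_integral_cong_AE, eventually_elim)
      fix \<omega> :: "nat \<Rightarrow> real" assume nonneg: "\<forall>i. 0 \<le> \<omega> i"
      show "indicator ?B \<omega> = (\<Sum>n. if arrival n \<omega> \<le> u \<and> u < arrival (Suc n) \<omega> then 1 else 0 :: ennreal)"
      proof (cases "\<omega> \<in> ?B")
        case True
        then obtain n where "arrival n \<omega> \<le> u" "u < arrival (Suc n) \<omega>" by auto
        from suminf_arrivals[OF nonneg this, of "\<lambda>_. 1"] True show ?thesis by simp
      next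
        case False
        then have "(if arrival n \<omega> \<le> u \<and> u < arrival (Suc n) \<omega> then 1 else 0 :: ennreal) = 0" for n
          by auto
        with False show ?thesis by (simp only:) simp
      qed
    qed
    also have "\<dots> = (\<Sum>n. \<integral>\<^sup>+\<omega>. (if arrival n \<omega> \<le> u \<and> u < arrival (Suc n) \<omega> then 1 else 0) \<partial>marked_times)"
      by (rule nn_integral_suminf) measurable
    also have "\<dots> = (\<Sum>n. ennreal (pois u n))"
      using markov_count[where f="\<lambda>_. 1" and G="\<lambda>_. 1"]
      by (simp add: emeasure_space_1[simplified] cong: if_cong)
    also have "\<dots> = 1"
      using suminf_pois[OF u, of 1] by simp
    finally have "prob ?B = 1" by (simp add: emeasure_eq_measure)
    with prob_Collect_eq_1[OF B] show ?thesis by blast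
  qed
  \<comment> \<open>Integer times suffice: they are countably many, and every real lies below one of
    them.\<close>
  then have "AE \<omega> in marked_times. \<forall>m::nat. \<exists>n. arrival n \<omega> \<le> real m \<and> real m < arrival (Suc n) \<omega>"
    by (simp add: AE_all_countable)
  with AE_nonneg show ?thesis
  proof eventually_elim
    case (elim \<omega>)
    have "\<exists>n. t < arrival n \<omega>" for t
    proof -
      obtain m :: nat where "t < real m" using reals_Archimedean2 by blast
      with elim(2) show ?thesis by (meson less_trans)
    qed
    with elim(1) show ?case by (simp add: regular_def)
  qed
qed

section \<open>Restarting the process at a fixed time\<close>

lemma regular_arrivals:
  assumes "regular \<omega>" "0 \<le> u"
  obtains n where "arrival n \<omega> \<le> u" "u < arrival (Suc n) \<omega>"
proof -
  have ex: "\<exists>n. u < arrival n \<omega>" using assms(1) by (simp add: regular_def)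
  define n where "n = (LEAST n. u < arrival n \<omega>)"
  have n: "u < arrival n \<omega>" unfolding n_def by (rule LeastI_ex[OF ex])
  with assms(2) have "n \<noteq> 0" by (intro notI) simp
  then obtain m where m: "n = Suc m" using not0_implies_Suc by blast
  have "\<not> u < arrival m \<omega>" by (rule not_less_Least) (simp add: n_def[symmetric] m)
  with n m that[of m] show ?thesis by simp
qed

text \<open>Any \<open>n\<close> with \<open>t < arrival n \<omega>\<close> is allowed, so one
  finite sum serves all times before that arrival; continuity and monotonicity of paths rely on
  this.\<close>

lemma cpp_eq_sum:
  assumes "\<forall>i. 0 \<le> \<omega> i" "t < arrival n \<omega>"
  shows "cpp t \<omega> = (\<Sum>k<n. if arrival (Suc k) \<omega> \<le> t then \<omega> (2 * k + 1) else 0)"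
  unfolding cpp_def
proof (rule suminf_finite)
  fix k assume "k \<notin> {..<n}"
  then have "t < arrival (Suc k) \<omega>"
    using arrival_mono[OF assms(1), of n "Suc k"] assms(2) by simp
  then show "(if arrival (Suc k) \<omega> \<le> t then \<omega> (2 * k + 1) else 0) = 0" by simp
qed simp

lemma cpp_eq_jump_sum:
  assumes "\<forall>i. 0 \<le> \<omega> i" "arrival n \<omega> \<le> u" "u < arrival (Suc n) \<omega>"
  shows "cpp u \<omega> = jump_sum n \<omega>"
proof -
  have "arrival (Suc k) \<omega> \<le> u" if "k < n" for k
    using arrival_mono[OF assms(1), of "Suc k" n] assms(2) that by simp
  then show ?thesis
    using assms(3) by (subst cpp_eq_sum[OF assms(1,3)]) (simp add: jump_sum_def)
qed

text \<open>The first \<open>n\<close> jumps have all happened by \<open>u\<close>, and the rest of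
  the series is the series of the restarted sequence.\<close>

lemma cpp_add:
  assumes "regular \<omega>" "arrival n \<omega> \<le> u" "u < arrival (Suc n) \<omega>" "0 \<le> v"
  shows "cpp (u + v) \<omega> = jump_sum n \<omega> + cpp v (restart u n \<omega>)"
proof -
  let ?f = "\<lambda>k. if arrival (Suc k) \<omega> \<le> u + v then \<omega> (2 * k + 1) else 0"
  have nonneg: "\<forall>i. 0 \<le> \<omega> i" using assms(1) by (simp add: regular_def)
  obtain m where m: "u + v < arrival m \<omega>" using assms(1) by (auto simp: regular_def)
  have "?f k = 0" if "k \<notin> {..<m}" for k
    using arrival_mono[OF nonneg, of m "Suc k"] m that by auto
  then have "summable ?f" by (intro summable_finite[of "{..<m}"]) auto
  then have "cpp (u + v) \<omega> = (\<Sum>k. ?f (k + n)) + (\<Sum>k<n. ?f k)"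
    unfolding cpp_def by (rule suminf_split_initial_segment)
  moreover have "?f k = \<omega> (2 * k + 1)" if "k < n" for k
    using arrival_mono[OF nonneg, of "Suc k" n] assms(2,4) that by auto
  then have "(\<Sum>k<n. ?f k) = jump_sum n \<omega>" by (simp add: jump_sum_def)
  moreover have "restart u n \<omega> (2 * k + 1) = \<omega> (2 * (k + n) + 1)" for k
    by (simp add: restart_def algebra_simps)
  then have "?f (k + n) =
    (if arrival (Suc k) (restart u n \<omega>) \<le> v then restart u n \<omega> (2 * k + 1) else 0)" for k
    by (auto simp: arrival_restart)
  then have "(\<Sum>k. ?f (k + n)) = cpp v (restart u n \<omega>)" by (simp add: cpp_def)
  ultimately show ?thesis by simp
qed

text \<open>Sums \<open>markov_count\<close> over the number of arrivals by \<open>u\<close>. The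
  integral of \<open>G\<close> does not depend on that number and leaves the sum, which makes the
  future independent of \<open>cpp u\<close>.\<close>

lemma nn_integral_cpp_restart:
  assumes [measurable]: "f \<in> borel_measurable borel" "G \<in> borel_measurable (PiM UNIV (\<lambda>_. borel))"
    and u: "0 \<le> u"
    and H: "\<And>\<omega> n. regular \<omega> \<Longrightarrow> arrival n \<omega> \<le> u \<Longrightarrow> u < arrival (Suc n) \<omega> \<Longrightarrow> H \<omega> = G (restart u n \<omega>)"
  shows "(\<integral>\<^sup>+\<omega>. f (cpp u \<omega>) * H \<omega> \<partial>marked_times) =
    (\<Sum>n. ennreal (pois u n) * (\<integral>\<^sup>+\<omega>. f (jump_sum n \<omega>) \<partial>marked_times)) * (\<integral>\<^sup>+\<omega>. G \<omega> \<partial>marked_times)"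
proof -
  have "(\<integral>\<^sup>+\<omega>. f (cpp u \<omega>) * H \<omega> \<partial>marked_times) =
    (\<integral>\<^sup>+\<omega>. (\<Sum>n. if arrival n \<omega> \<le> u \<and> u < arrival (Suc n) \<omega>
        then f (jump_sum n \<omega>) * G (restart u n \<omega>) else 0) \<partial>marked_times)"
    using AE_regular
  proof (intro nn_integral_cong_AE, eventually_elim)
    fix \<omega> assume reg: "regular \<omega>"
    then have nonneg: "\<forall>i. 0 \<le> \<omega> i" by (simp add: regular_def)
    obtain n where n: "arrival n \<omega> \<le> u" "u < arrival (Suc n) \<omega>"
      using regular_arrivals[OF reg u] .
    show "f (cpp u \<omega>) * H \<omega> = (\<Sum>n. if arrival n \<omega> \<le> u \<and> u < arrival (Suc n) \<omega>
        then f (jump_sum n \<omega>) * G (restart u n \<omega>) else 0)"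
      using suminf_arrivals[OF nonneg n, of "\<lambda>n. f (jump_sum n \<omega>) * G (restart u n \<omega>)"]
        cpp_eq_jump_sum[OF nonneg n] H[OF reg n] by simp
  qed
  also have "\<dots> = (\<Sum>n. \<integral>\<^sup>+\<omega>. (if arrival n \<omega> \<le> u \<and> u < arrival (Suc n) \<omega>
        then f (jump_sum n \<omega>) * G (restart u n \<omega>) else 0) \<partial>marked_times)"
    by (rule nn_integral_suminf) measurable
  finally show ?thesis by (simp add: markov_count ennreal_suminf_multc)
qed

lemma nn_integral_cpp:
  assumes [measurable]: "f \<in> borel_measurable borel" and "0 \<le> u"
  shows "(\<integral>\<^sup>+\<omega>. f (cpp u \<omega>) \<partial>marked_times) =
    (\<Sum>n. ennreal (pois u n) * (\<integral>\<^sup>+\<omega>. f (jump_sum n \<omega>) \<partial>marked_times))"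
  using nn_integral_cpp_restart[OF assms(1) _ assms(2), of "\<lambda>_. 1" "\<lambda>_. 1"]
  by (simp add: emeasure_space_1[simplified])

text \<open>In a difference of values after \<open>u\<close> the common term
  \<open>jump_sum m \<omega>\<close> cancels, so these increments are functions of the restarted
  sequence alone.\<close>

lemma markov_increments:
  fixes g :: "nat \<Rightarrow> real \<Rightarrow> ennreal"
  assumes [measurable]: "f \<in> borel_measurable borel" "\<And>i. g i \<in> borel_measurable borel"
    and u: "0 \<le> u" and ab: "\<And>i. i < n \<Longrightarrow> u \<le> a i \<and> u \<le> b i"
  shows "(\<integral>\<^sup>+\<omega>. f (cpp u \<omega>) * (\<Prod>i<n. g i (cpp (a i) \<omega> - cpp (b i) \<omega>)) \<partial>marked_times) =
    (\<integral>\<^sup>+\<omega>. f (cpp u \<omega>) \<partial>marked_times) *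
    (\<integral>\<^sup>+\<omega>. (\<Prod>i<n. g i (cpp (a i - u) \<omega> - cpp (b i - u) \<omega>)) \<partial>marked_times)"
  unfolding nn_integral_cpp[OF assms(1) u]
proof (rule nn_integral_cpp_restart[OF assms(1) _ u])
  fix \<omega> m assume *: "regular \<omega>" "arrival m \<omega> \<le> u" "u < arrival (Suc m) \<omega>"
  have "cpp t \<omega> = jump_sum m \<omega> + cpp (t - u) (restart u m \<omega>)" if "u \<le> t" for t
    using cpp_add[OF *, of "t - u"] that by simp
  then show "(\<Prod>i<n. g i (cpp (a i) \<omega> - cpp (b i) \<omega>)) =
    (\<Prod>i<n. g i (cpp (a i - u) (restart u m \<omega>) - cpp (b i - u) (restart u m \<omega>)))"
    using ab by (intro prod.cong) auto
qed measurable

section \<open>Independence and stationarity of increments\<close>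

lemma AE_cpp_0: "AE \<omega> in marked_times. cpp 0 \<omega> = 0"
proof -
  \<comment> \<open>Since \<open>0 ^ 0 = 1\<close>, all Poisson weight at time 0 sits on
    \<open>n = 0\<close>. A sequence whose first wait is 0 may still jump at time 0, so the claim is
    only almost sure.\<close>
  have "pois 0 n = (if n = 0 then 1 else 0)" for n by (simp add: pois_def)
  then have "(\<integral>\<^sup>+\<omega>. indicator {x. x \<noteq> 0} (cpp 0 \<omega>) \<partial>marked_times) =
    (\<Sum>n. if n = 0 then \<integral>\<^sup>+\<omega>. indicator {x. x \<noteq> 0} (jump_sum n \<omega>) \<partial>marked_times else 0)"
    by (subst nn_integral_cpp) (auto intro!: suminf_cong)
  also have "\<dots> = 0"
    by (auto simp: suminf_eq_zero_iff)
  finally show ?thesis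
    by (subst (asm) nn_integral_0_iff_AE) (auto simp: indicator_eq_0_iff)
qed

text \<open>By induction: \<open>markov_increments\<close> at time \<open>t 1\<close> separates the
  first increment, and the remaining times, shifted by \<open>t 1\<close>, start at 0 again.\<close>

lemma nn_integral_increments_from_0:
  fixes g :: "nat \<Rightarrow> real \<Rightarrow> ennreal"
  assumes "\<And>i. g i \<in> borel_measurable borel" "t 0 = 0" "\<And>i. i < n \<Longrightarrow> t i \<le> t (Suc i)"
  shows "(\<integral>\<^sup>+\<omega>. (\<Prod>i<n. g i (cpp (t (Suc i)) \<omega> - cpp (t i) \<omega>)) \<partial>marked_times) =
    (\<Prod>i<n. \<integral>\<^sup>+\<omega>. g i (cpp (t (Suc i) - t i) \<omega>) \<partial>marked_times)"
  using assms
proof (induction n arbitrary: g t)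
  case 0
  then show ?case by (simp add: emeasure_space_1[simplified])
next
  case (Suc n)
  note [measurable] = Suc.prems(1)
  have t1: "t 1 \<le> t (Suc i)" if "i \<le> n" for i
    using that Suc.prems(3) by (induction i) (auto intro: order_trans)
  have "(\<integral>\<^sup>+\<omega>. (\<Prod>i<Suc n. g i (cpp (t (Suc i)) \<omega> - cpp (t i) \<omega>)) \<partial>marked_times) =
    (\<integral>\<^sup>+\<omega>. g 0 (cpp (t 1) \<omega>) * (\<Prod>i<n. g (Suc i) (cpp (t (Suc (Suc i))) \<omega> - cpp (t (Suc i)) \<omega>)) \<partial>marked_times)"
    \<comment> \<open>As \<open>cpp 0\<close> vanishes almost surely, the first increment is the
      value \<open>cpp (t 1)\<close> itself, in the form that \<open>markov_increments\<close>
      expects.\<close>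
    using AE_cpp_0 by (intro nn_integral_cong_AE, eventually_elim)
      (simp add: prod.lessThan_Suc_shift Suc.prems(2) del: prod.lessThan_Suc)
  also have "\<dots> = (\<integral>\<^sup>+\<omega>. g 0 (cpp (t 1) \<omega>) \<partial>marked_times) *
    (\<integral>\<^sup>+\<omega>. (\<Prod>i<n. g (Suc i) (cpp (t (Suc (Suc i)) - t 1) \<omega> - cpp (t (Suc i) - t 1) \<omega>)) \<partial>marked_times)"
    using Suc.prems(2) Suc.prems(3)[of 0] t1
    by (intro markov_increments) auto
  also have "(\<integral>\<^sup>+\<omega>. (\<Prod>i<n. g (Suc i) (cpp (t (Suc (Suc i)) - t 1) \<omega> - cpp (t (Suc i) - t 1) \<omega>)) \<partial>marked_times) =
    (\<Prod>i<n. \<integral>\<^sup>+\<omega>. g (Suc i) (cpp (t (Suc (Suc i)) - t (Suc i)) \<omega>) \<partial>marked_times)"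
    using Suc.IH[of "\<lambda>i. g (Suc i)" "\<lambda>i. t (Suc i) - t 1"] Suc.prems by simp
  finally show ?case by (simp add: prod.lessThan_Suc_shift Suc.prems(2) del: prod.lessThan_Suc)
qed

text \<open>The Markov property at \<open>t 0\<close> with trivial past \<open>f = 1\<close> moves
  the starting time to 0.\<close>

lemma nn_integral_increments:
  fixes g :: "nat \<Rightarrow> real \<Rightarrow> ennreal"
  assumes [measurable]: "\<And>i. g i \<in> borel_measurable borel"
    and t: "0 \<le> t 0" "\<And>i. i < n \<Longrightarrow> t i \<le> t (Suc i)"
  shows "(\<integral>\<^sup>+\<omega>. (\<Prod>i<n. g i (cpp (t (Suc i)) \<omega> - cpp (t i) \<omega>)) \<partial>marked_times) =
    (\<Prod>i<n. \<integral>\<^sup>+\<omega>. g i (cpp (t (Suc i) - t i) \<omega>) \<partial>marked_times)"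
proof -
  have t0: "t 0 \<le> t i" if "i \<le> n" for i
    using that t(2) by (induction i) (auto intro: order_trans)
  have "(\<integral>\<^sup>+\<omega>. (\<Prod>i<n. g i (cpp (t (Suc i)) \<omega> - cpp (t i) \<omega>)) \<partial>marked_times) =
    (\<integral>\<^sup>+\<omega>. (\<Prod>i<n. g i (cpp (t (Suc i) - t 0) \<omega> - cpp (t i - t 0) \<omega>)) \<partial>marked_times)"
    using markov_increments[of "\<lambda>_. 1" g "t 0" n "\<lambda>i. t (Suc i)" t] t t0
    by (simp add: emeasure_space_1[simplified])
  also have "\<dots> = (\<Prod>i<n. \<integral>\<^sup>+\<omega>. g i (cpp (t (Suc i) - t i) \<omega>) \<partial>marked_times)"
    using nn_integral_increments_from_0[of g "\<lambda>i. t i - t 0" n] t by simp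
  finally show ?thesis .
qed

lemma nn_integral_increment:
  assumes [measurable]: "g \<in> borel_measurable borel" and st: "0 \<le> s" "s \<le> t"
  shows "(\<integral>\<^sup>+\<omega>. g (cpp t \<omega> - cpp s \<omega>) \<partial>marked_times) = (\<integral>\<^sup>+\<omega>. g (cpp (t - s) \<omega>) \<partial>marked_times)"
  using nn_integral_increments[of "\<lambda>_. g" "\<lambda>i. if i = 0 then s else t" 1] st by simp

lemma distr_increment:
  assumes "0 \<le> s" "s \<le> t"
  shows "distr marked_times borel (\<lambda>\<omega>. cpp t \<omega> - cpp s \<omega>) = distr marked_times borel (cpp (t - s))"
proof (rule measure_eqI)
  fix A assume "A \<in> sets (distr marked_times borel (\<lambda>\<omega>. cpp t \<omega> - cpp s \<omega>))"
  then have [measurable]: "A \<in> sets borel" by simp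
  have "emeasure (distr marked_times borel X) A = (\<integral>\<^sup>+\<omega>. indicator A (X \<omega>) \<partial>marked_times)"
    if [measurable]: "X \<in> borel_measurable marked_times" for X
    by (simp add: nn_integral_indicator[symmetric] nn_integral_distr del: nn_integral_indicator)
  then show "emeasure (distr marked_times borel (\<lambda>\<omega>. cpp t \<omega> - cpp s \<omega>)) A =
      emeasure (distr marked_times borel (cpp (t - s))) A"
    using nn_integral_increment[of "indicator A", OF _ assms] by simp
qed simp

text \<open>With indicators for \<open>g i\<close> the product formula becomes the product rule for
  events. The constant 1 outside \<open>J\<close> lets the formula for all \<open>n\<close>
  increments cover every subfamily.\<close>

lemma indep_increments:
  assumes t: "0 \<le> t 0" "\<And>i. i < n \<Longrightarrow> t i \<le> t (Suc i)"
  shows "indep_vars (\<lambda>_. borel) (\<lambda>i \<omega>. cpp (t (Suc i)) \<omega> - cpp (t i) \<omega>) {..<n}"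
  unfolding indep_vars_def2
proof (intro conjI ballI indep_setsI)
  let ?X = "\<lambda>i \<omega>. cpp (t (Suc i)) \<omega> - cpp (t i) \<omega>"
  show rv: "random_variable borel (?X i)" for i by measurable
  have vimage: "?X i -` A \<inter> space marked_times \<in> events" if "A \<in> sets borel" for A i
    using rv that by (rule measurable_sets)
  then show "{?X i -` A \<inter> space marked_times |A. A \<in> sets borel} \<subseteq> events" for i
    by auto
  fix A J assume J: "J \<noteq> {}" "J \<subseteq> {..<n}" "finite J"
    and A: "\<forall>j\<in>J. A j \<in> {?X j -` B \<inter> space marked_times |B. B \<in> sets borel}"
  have t0: "0 \<le> t i" if "i \<le> n" for i
    using that t(2) by (induction i) (auto intro: t(1) order_trans)
  have "\<forall>j\<in>J. \<exists>B. B \<in> sets borel \<and> A j = ?X j -` B" using A by auto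
  then obtain B where B: "\<And>j. j \<in> J \<Longrightarrow> B j \<in> sets borel" "\<And>j. j \<in> J \<Longrightarrow> A j = ?X j -` B j"
    by metis
  define g :: "nat \<Rightarrow> real \<Rightarrow> ennreal" where "g i = (if i \<in> J then indicator (B i) else (\<lambda>_. 1))" for i
  have g[measurable]: "g i \<in> borel_measurable borel" for i using B(1) by (simp add: g_def)
  have A_events: "A j \<in> events" if "j \<in> J" for j
    using vimage[OF B(1)[OF that], of j] B(2)[OF that] by simp
  have "(\<Prod>i<n. g i (?X i \<omega>)) = indicator (\<Inter>j\<in>J. A j) \<omega>" for \<omega>
  proof -
    have "(\<Prod>i<n. g i (?X i \<omega>)) = (\<Prod>i\<in>J. g i (?X i \<omega>))"
      using J by (intro prod.mono_neutral_right) (auto simp: g_def)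
    also have "\<dots> = (\<Prod>i\<in>J. indicator (A i) \<omega>)"
      by (intro prod.cong) (auto simp: g_def B(2) split: split_indicator)
    finally show ?thesis using J by (auto simp: indicator_def prod_zero_iff)
  qed
  then have "emeasure marked_times (\<Inter>j\<in>J. A j) = (\<integral>\<^sup>+\<omega>. (\<Prod>i<n. g i (?X i \<omega>)) \<partial>marked_times)"
    using J A_events by (simp add: sets.finite_INT)
  also have "\<dots> = (\<Prod>i<n. \<integral>\<^sup>+\<omega>. g i (cpp (t (Suc i) - t i) \<omega>) \<partial>marked_times)"
    using t by (intro nn_integral_increments) simp_all
  also have "\<dots> = (\<Prod>i<n. \<integral>\<^sup>+\<omega>. g i (?X i \<omega>) \<partial>marked_times)"
    \<comment> \<open>Stationarity read backwards: \<open>cpp (t (Suc i) - t i)\<close> is traded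
      for the increment itself.\<close>
    using t(2) t0 by (intro prod.cong) (simp_all add: nn_integral_increment)
  also have "\<dots> = (\<Prod>i\<in>J. \<integral>\<^sup>+\<omega>. g i (?X i \<omega>) \<partial>marked_times)"
    using J by (intro prod.mono_neutral_right) (auto simp: g_def emeasure_space_1[simplified])
  also have "\<dots> = (\<Prod>i\<in>J. emeasure marked_times (A i))"
  proof (intro prod.cong)
    fix i assume i: "i \<in> J"
    then have "g i (?X i \<omega>) = indicator (A i) \<omega>" for \<omega>
      by (auto simp: g_def B(2) split: split_indicator)
    then show "(\<integral>\<^sup>+\<omega>. g i (?X i \<omega>) \<partial>marked_times) = emeasure marked_times (A i)"
      using A_events[OF i] by simp
  qed simp
  finally show "prob (\<Inter>j\<in>J. A j) = (\<Prod>j\<in>J. prob (A j))"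
    by (simp add: emeasure_eq_measure prod_ennreal prod_nonneg)
qed

section \<open>Path properties and the Laplace exponent\<close>

lemma cadlag_cpp:
  assumes "regular \<omega>"
  shows "cadlag (\<lambda>t. cpp t \<omega>)"
proof -
  let ?f = "\<lambda>m s. \<Sum>k<m. if arrival (Suc k) \<omega> \<le> s then \<omega> (2 * k + 1) else 0"
  have nonneg: "\<forall>i. 0 \<le> \<omega> i" using assms by (simp add: regular_def)
  have *: "continuous (at_right t) (\<lambda>s. cpp s \<omega>) \<and> (\<exists>l. ((\<lambda>s. cpp s \<omega>) \<longlongrightarrow> l) (at_left t))" for t
  proof -
    \<comment> \<open>A single \<open>m\<close> serves a whole neighbourhood of \<open>t\<close>, on
      which the path is one finite sum of steps.\<close>
    obtain m where m: "t < arrival m \<omega>" using assms by (auto simp: regular_def)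
    have eq: "cpp s \<omega> = ?f m s" if "s < arrival m \<omega>" for s
      using cpp_eq_sum[OF nonneg that] .
    have "\<forall>\<^sub>F s in at_right t. ?f m s = cpp s \<omega>"
      by (rule eventually_at_rightI[OF _ m]) (simp add: eq)
    moreover have "(?f m \<longlongrightarrow> ?f m t) (at_right t)"
      using step_continuous_right unfolding continuous_within by (intro tendsto_sum)
    ultimately have "continuous (at_right t) (\<lambda>s. cpp s \<omega>)"
      unfolding continuous_within eq[OF m] by (rule Lim_transform_eventually[rotated])
    moreover have "\<forall>\<^sub>F s in at_left t. ?f m s = cpp s \<omega>"
      by (rule eventually_at_leftI[of "t - 1"]) (use m in \<open>simp_all add: eq\<close>)
    then have "((\<lambda>s. cpp s \<omega>) \<longlongrightarrow> (\<Sum>k<m. if arrival (Suc k) \<omega> < t then \<omega> (2 * k + 1) else 0)) (at_left t)"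
      by (rule Lim_transform_eventually[rotated]) (intro tendsto_sum step_left_limit)
    ultimately show ?thesis by blast
  qed
  then show ?thesis by (simp add: cadlag_def)
qed

lemma mono_cpp:
  assumes "regular \<omega>"
  shows "mono (\<lambda>t. cpp t \<omega>)"
proof (rule monoI)
  fix s t :: real assume st: "s \<le> t"
  have nonneg: "\<forall>i. 0 \<le> \<omega> i" using assms by (simp add: regular_def)
  obtain m where m: "t < arrival m \<omega>" using assms by (auto simp: regular_def)
  with st have "s < arrival m \<omega>" by simp
  then show "cpp s \<omega> \<le> cpp t \<omega>"
    unfolding cpp_eq_sum[OF nonneg m] cpp_eq_sum[OF nonneg \<open>s < arrival m \<omega>\<close>]
    using st nonneg by (intro sum_mono) auto
qed

lemma subordinator_cpp: "subordinator marked_times cpp"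
  unfolding subordinator_def levy_process_def
proof (intro conjI allI impI)
  show "AE \<omega> in marked_times. cadlag (\<lambda>t. cpp t \<omega>)"
    using AE_regular by eventually_elim (rule cadlag_cpp)
  show "AE \<omega> in marked_times. mono_on {0..} (\<lambda>t. cpp t \<omega>)"
    using AE_regular by eventually_elim (auto intro: mono_cpp[THEN mono_on_subset])
qed (auto intro: prob_space_marked_times AE_cpp_0 indep_increments distr_increment)

lemma nn_integral_exp_jump_sum:
  assumes \<eta>: "0 \<le> \<eta>"
  shows "(\<integral>\<^sup>+\<omega>. ennreal (exp (- \<eta> * jump_sum n \<omega>)) \<partial>marked_times) = ennreal ((LINT y|\<mu>. exp (- \<eta> * y)) ^ n)"
proof (induction n)
  case 0
  then show ?case by (simp add: emeasure_space_1[simplified])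
next
  case (Suc n)
  have "AE y in \<mu>. norm (exp (- \<eta> * y)) \<le> 1"
    using jump_nonneg by eventually_elim (use \<eta> in simp)
  then have int: "integrable \<mu> (\<lambda>y. exp (- \<eta> * y))"
    by (intro J.integrable_const_bound[where B=1]) simp_all
  have "(\<integral>\<^sup>+\<omega>. ennreal (exp (- \<eta> * jump_sum (Suc n) \<omega>)) \<partial>marked_times) =
    (\<integral>\<^sup>+y. \<integral>\<^sup>+\<omega>. ennreal (exp (- \<eta> * (y + jump_sum n \<omega>))) \<partial>marked_times \<partial>\<mu>)"
    by (rule nn_integral_jump_sum_Suc[of "\<lambda>x. ennreal (exp (- \<eta> * x))"]) measurable
  also have "\<dots> = (\<integral>\<^sup>+y. \<integral>\<^sup>+\<omega>. ennreal (exp (- \<eta> * y)) * ennreal (exp (- \<eta> * jump_sum n \<omega>)) \<partial>marked_times \<partial>\<mu>)"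
    by (simp add: ennreal_mult[symmetric] exp_add[symmetric] algebra_simps)
  also have "\<dots> = (\<integral>\<^sup>+y. ennreal (exp (- \<eta> * y)) \<partial>\<mu>) * ennreal ((LINT y|\<mu>. exp (- \<eta> * y)) ^ n)"
    by (subst nn_integral_cmult) (simp_all add: nn_integral_multc Suc.IH[simplified])
  also have "(\<integral>\<^sup>+y. ennreal (exp (- \<eta> * y)) \<partial>\<mu>) = ennreal (LINT y|\<mu>. exp (- \<eta> * y))"
    by (rule nn_integral_eq_integral[OF int]) simp
  finally show ?case by (simp add: ennreal_mult)
qed

text \<open>Given \<open>n\<close> arrivals the transform of the jump sum is the \<open>n\<close>-th
  power of that of one jump, and \<open>suminf_pois\<close> sums these powers.\<close>

lemma laplace_exponent_cpp:
  "has_laplace_exponent marked_times cpp (\<lambda>\<eta>. l * (1 - (LINT y|\<mu>. exp (- \<eta> * y))))"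
  unfolding has_laplace_exponent_def
proof (intro allI impI)
  fix \<eta> t :: real assume "0 \<le> \<eta>" "0 \<le> t"
  let ?c = "LINT y|\<mu>. exp (- \<eta> * y)"
  have "(\<integral>\<^sup>+\<omega>. ennreal (exp (- \<eta> * cpp t \<omega>)) \<partial>marked_times) =
      (\<Sum>n. ennreal (pois t n) * (\<integral>\<^sup>+\<omega>. ennreal (exp (- \<eta> * jump_sum n \<omega>)) \<partial>marked_times))"
    by (rule nn_integral_cpp[of "\<lambda>x. ennreal (exp (- \<eta> * x))"]) (use \<open>0 \<le> t\<close> in simp_all)
  also have "\<dots> = (\<Sum>n. ennreal (pois t n * ?c ^ n))"
    by (simp only: nn_integral_exp_jump_sum[OF \<open>0 \<le> \<eta>\<close>] ennreal_mult'[OF pois_nonneg])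
  also have "\<dots> = ennreal (exp (- l * t * (1 - ?c)))"
    by (rule suminf_pois[OF \<open>0 \<le> t\<close>]) simp
  finally have "(LINT \<omega>|marked_times. exp (- \<eta> * cpp t \<omega>)) = exp (- l * t * (1 - ?c))"
    by (subst integral_eq_nn_integral) simp_all
  also have "- l * t * (1 - ?c) = - t * (l * (1 - ?c))"
    by (simp add: mult_ac)
  finally show "(LINT \<omega>|marked_times. exp (- \<eta> * cpp t \<omega>)) = exp (- t * (l * (1 - ?c)))" .
qed

end

section \<open>Subordinators from finite Levy measures\<close>

lemma subordinator_of_finite_levy_measure:
  fixes \<pi> :: "real measure"
  assumes sets: "sets \<pi> = sets lborel_pos" and mass: "emeasure \<pi> {0<..} = ennreal m" and m: "0 < m"
  obtains M :: "(nat \<Rightarrow> real) measure" and S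
  where "subordinator M S" "has_laplace_exponent M S (\<lambda>\<eta>. LINT s|\<pi>. 1 - exp (- s * \<eta>))"
proof -
  have space: "space \<pi> = {0<..}"
    using sets_eq_imp_space_eq[OF sets] by (simp add: space_restrict_space)
  interpret P: finite_measure \<pi>
    by (rule finite_measureI) (simp add: space mass)
  have borel: "f \<in> borel_measurable \<pi>" if "f \<in> borel_measurable borel" for f :: "real \<Rightarrow> real"
    using that by (simp add: measurable_cong_sets[OF sets refl] measurable_restrict_space1)
  \<comment> \<open>The total mass \<open>m\<close> serves as the jump rate and the normalised
    measure as the jump law; multiplying by \<open>m\<close> in the exponent undoes the
    normalisation.\<close>
  define D where "D = density \<pi> (\<lambda>_. ennreal (1 / m))"
  have id: "(\<lambda>x. x) \<in> borel_measurable D"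
    using borel[of "\<lambda>x. x"] by (simp add: D_def)
  \<comment> \<open>The measure lives on the positive half-line, whereas the locale wants a jump law
    on the Borel sets of the whole line.\<close>
  define \<mu> where "\<mu> = distr D borel (\<lambda>x. x)"
  have "prob_space \<mu>"
  proof
    have "emeasure \<mu> (space \<mu>) = emeasure D (space \<pi>)"
      using id by (simp add: \<mu>_def emeasure_distr) (simp add: D_def)
    also have "\<dots> = ennreal (1 / m) * emeasure \<pi> (space \<pi>)"
      unfolding D_def by (rule emeasure_density_const) simp
    also have "\<dots> = 1"
      using m by (simp add: mass space ennreal_mult[symmetric])
    finally show "emeasure \<mu> (space \<mu>) = 1" .
  qed
  moreover have "AE y in \<mu>. 0 \<le> y"
  proof -
    have "AE y in D. 0 \<le> y"
      by (rule AE_I2) (simp add: D_def space)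
    then show ?thesis
      unfolding \<mu>_def using id by (subst AE_distr_iff) simp_all
  qed
  moreover have "sets \<mu> = sets borel"
    by (simp add: \<mu>_def)
  ultimately interpret compound_poisson m \<mu>
    by (simp add: compound_poisson_def m)
  have exponent: "m * (1 - (LINT y|\<mu>. exp (- \<eta> * y))) = (LINT s|\<pi>. 1 - exp (- s * \<eta>))" if "0 \<le> \<eta>" for \<eta>
  proof -
    have meas: "(\<lambda>s. exp (- s * \<eta>)) \<in> borel_measurable \<pi>"
      by (rule borel) measurable
    have int: "integrable \<pi> (\<lambda>s. exp (- s * \<eta>))"
      using meas by (rule P.integrable_const_bound[where B=1, rotated])
        (use that in \<open>auto simp: space intro!: AE_I2\<close>)
    have "(LINT y|\<mu>. exp (- \<eta> * y)) = (LINT s|D. exp (- s * \<eta>))"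
      unfolding \<mu>_def using id by (subst integral_distr) (simp_all add: mult.commute)
    also have "\<dots> = (LINT s|\<pi>. (1 / m) *\<^sub>R exp (- s * \<eta>))"
      unfolding D_def using m meas by (intro integral_density) simp_all
    finally have "m * (LINT y|\<mu>. exp (- \<eta> * y)) = (LINT s|\<pi>. exp (- s * \<eta>))"
      using m by simp
    moreover have "(LINT s|\<pi>. 1 - exp (- s * \<eta>)) = m - (LINT s|\<pi>. exp (- s * \<eta>))"
      using mass m int by (simp add: measure_def space)
    ultimately show ?thesis
      by (simp add: right_diff_distrib)
  qed
  have "has_laplace_exponent marked_times cpp (\<lambda>\<eta>. LINT s|\<pi>. 1 - exp (- s * \<eta>))"
    unfolding has_laplace_exponent_def
  proof (intro allI impI)
    fix \<eta> t :: real assume "0 \<le> \<eta>" "0 \<le> t"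
    then have "(LINT \<omega>|marked_times. exp (- \<eta> * cpp t \<omega>)) = exp (- t * (m * (1 - (LINT y|\<mu>. exp (- \<eta> * y)))))"
      using laplace_exponent_cpp unfolding has_laplace_exponent_def by blast
    then show "(LINT \<omega>|marked_times. exp (- \<eta> * cpp t \<omega>)) = exp (- t * (LINT s|\<pi>. 1 - exp (- s * \<eta>)))"
      by (simp only: exponent[OF \<open>0 \<le> \<eta>\<close>])
  qed
  with subordinator_cpp show thesis by (rule that)
qed

subsection \<open>The density\<close>

text \<open>A cone of functions stable under \<open>- d/dx\<close> on \<open>(1, \<infinity>)\<close>.\<close>

inductive cm_beyond_1 :: "(real \<Rightarrow> real) \<Rightarrow> bool" where
  base: "0 \<le> c \<Longrightarrow> 0 \<le> p \<Longrightarrow> 0 \<le> q \<Longrightarrow> cm_beyond_1 (\<lambda>x. c * (x - 1) powr (- p) * x powr (- q))"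
| add: "cm_beyond_1 f \<Longrightarrow> cm_beyond_1 g \<Longrightarrow> cm_beyond_1 (\<lambda>x. f x + g x)"

lemma cm_beyond_1_nonneg: "cm_beyond_1 f \<Longrightarrow> 0 \<le> f x"
  by (induction rule: cm_beyond_1.induct) auto

text \<open>The product rule turns a base term into two: one exponent, \<open>p\<close> or
  \<open>q\<close>, grows by 1 and the coefficient becomes \<open>c * p\<close> or
  \<open>c * q\<close>, still nonnegative. This is why the cone is closed under sums.\<close>

lemma cm_beyond_1_deriv:
  "cm_beyond_1 f \<Longrightarrow> \<exists>g. cm_beyond_1 g \<and> (\<forall>x>1. (f has_real_derivative - g x) (at x))"
proof (induction rule: cm_beyond_1.induct)
  case (base c p q)
  define g where "g x = c * p * (x - 1) powr (- p - 1) * x powr (- q) +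
    c * q * (x - 1) powr (- p) * x powr (- q - 1)" for x
  have "((\<lambda>x. c * (x - 1) powr (- p) * x powr (- q)) has_real_derivative - g x) (at x)" if "1 < x" for x
  proof -
    have "((\<lambda>x. (x - 1) powr (- p)) has_real_derivative - p * (x - 1) powr (- p - 1)) (at x)"
      using that by (auto intro!: derivative_eq_intros)
    moreover have "((\<lambda>x. x powr (- q)) has_real_derivative - q * x powr (- q - 1)) (at x)"
      using that by (auto intro!: derivative_eq_intros)
    ultimately have "((\<lambda>x. c * ((x - 1) powr (- p) * x powr (- q))) has_real_derivative
        c * (- p * (x - 1) powr (- p - 1) * x powr (- q) + - q * x powr (- q - 1) * (x - 1) powr (- p))) (at x)"
      by (intro DERIV_cmult DERIV_mult)
    then show ?thesis by (simp add: g_def algebra_simps)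
  qed
  moreover have "cm_beyond_1 g"
    using cm_beyond_1.add[OF cm_beyond_1.base[of "c * p" "p + 1" q] cm_beyond_1.base[of "c * q" p "q + 1"]] base
    by (simp add: g_def[abs_def])
  ultimately show ?case by blast
next
  case (add f g)
  then obtain f' g' where "cm_beyond_1 f'" "\<forall>x>1. (f has_real_derivative - f' x) (at x)"
    "cm_beyond_1 g'" "\<forall>x>1. (g has_real_derivative - g' x) (at x)" by blast
  then show ?case
    by (intro exI[of _ "\<lambda>x. f' x + g' x"]) (auto intro!: cm_beyond_1.add derivative_eq_intros)
qed

text \<open>Each derivative is \<open>(- 1) ^ n\<close> times a member of the cone, by induction.
  Agreement on the open half-line is enough because derivatives are local.\<close>

lemma completely_monotone_beyond_1I:
  assumes f: "cm_beyond_1 f" and m: "\<And>x. 1 < x \<Longrightarrow> m x = f x"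
  shows "completely_monotone_beyond 1 m"
proof -
  have step: "((deriv ^^ n) m has_real_derivative (- 1) ^ Suc n * g' x) (at x)"
    if "\<forall>x>1. (deriv ^^ n) m x = (- 1) ^ n * g x"
      and "\<forall>x>1. (g has_real_derivative - g' x) (at x)" "1 < x" for n g g' x
  proof (rule has_field_derivative_transform_within_open)
    show "((\<lambda>x. (- 1) ^ n * g x) has_real_derivative (- 1) ^ Suc n * g' x) (at x)"
      using that by (auto intro!: derivative_eq_intros)
  qed (use that in \<open>auto intro: open_greaterThan[of 1]\<close>)
  have ex: "\<exists>g. cm_beyond_1 g \<and> (\<forall>x>1. (deriv ^^ n) m x = (- 1) ^ n * g x)" for n
  proof (induction n)
    case 0
    then show ?case using f m by auto
  next
    case (Suc n)
    then obtain g where g: "cm_beyond_1 g" "\<forall>x>1. (deriv ^^ n) m x = (- 1) ^ n * g x" by blast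
    obtain g' where g': "cm_beyond_1 g'" "\<forall>x>1. (g has_real_derivative - g' x) (at x)"
      using cm_beyond_1_deriv[OF g(1)] by blast
    have "\<forall>x>1. (deriv ^^ Suc n) m x = (- 1) ^ Suc n * g' x"
      using DERIV_imp_deriv[OF step[OF g(2) g'(2)]] by simp
    with g'(1) show ?case by blast
  qed
  show ?thesis
    unfolding completely_monotone_beyond_def
  proof (intro allI impI conjI)
    fix n and x :: real assume x: "1 < x"
    obtain g where g: "cm_beyond_1 g" "\<forall>x>1. (deriv ^^ n) m x = (- 1) ^ n * g x" using ex by blast
    obtain g' where "\<forall>x>1. (g has_real_derivative - g' x) (at x)"
      using cm_beyond_1_deriv[OF g(1)] by blast
    then show "(deriv ^^ n) m differentiable (at x)"
      using step[OF g(2) _ x] by (auto simp: real_differentiable_def)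
    have "(- 1) ^ n * (deriv ^^ n) m x = g x"
      using g(2) x by (simp add: power_mult_distrib[symmetric] flip: mult.assoc)
    then show "0 \<le> (- 1) ^ n * (deriv ^^ n) m x"
      using cm_beyond_1_nonneg[OF g(1)] by simp
  qed
qed

lemma completely_monotone_pi_density:
  assumes "0 < a" "a < 1"
  shows "completely_monotone_beyond 1 (pi_density a)"
proof (rule completely_monotone_beyond_1I)
  show "cm_beyond_1 (\<lambda>x. a / Gamma (1 - a) * (x - 1) powr (- a) * x powr (- 1))"
    using assms by (intro cm_beyond_1.base) (simp_all add: Gamma_real_pos less_imp_le)
  show "pi_density a x = a / Gamma (1 - a) * (x - 1) powr (- a) * x powr (- 1)" if "1 < x" for x
    using that by (simp add: pi_density_def powr_minus)
qed

section \<open>Integrals against the density\<close>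

lemma pi_density_nonneg: "0 < a \<Longrightarrow> a < 1 \<Longrightarrow> 0 \<le> pi_density a z"
  by (auto simp: pi_density_def Gamma_real_pos less_imp_le split: split_indicator)

lemma measurable_pi_density[measurable]: "pi_density a \<in> borel_measurable borel"
  unfolding pi_density_def by measurable

lemma nn_integral_shifted_gamma:
  assumes a: "a < 1" and w: "0 < w"
  shows "(\<integral>\<^sup>+z. ennreal (indicator {1..} z * (z - 1) powr (- a) * exp (- w * z)) \<partial>lborel) =
    ennreal (Gamma (1 - a) * w powr (a - 1) * exp (- w))" (is "?I = _")
proof -
  have pos: "0 < Gamma (1 - a)" using a by (simp add: Gamma_real_pos)
  \<comment> \<open>The substitution \<open>t = w * (z - 1)\<close> in the integral for
    \<open>Gamma (1 - a)\<close> produces the factor \<open>w * (w powr (- a) * exp w)\<close>;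
    \<open>c\<close> is its inverse and isolates \<open>?I\<close>.\<close>
  define c where "c = w powr (a - 1) * exp (- w)"
  have c: "0 \<le> c" "c * (w * (w powr (- a) * exp w)) = 1"
    using w by (simp_all add: c_def powr_diff powr_minus exp_minus field_simps)
  have "ennreal (Gamma (1 - a)) = (\<integral>\<^sup>+t. ennreal (indicator {0..} t * t powr (- a) / exp t) \<partial>lborel)"
    using Gamma_conv_nn_integral_real[of "1 - a"] a pos by simp
  also have "\<dots> = ennreal w * (\<integral>\<^sup>+z. ennreal (indicator {0..} (- w + w * z) * (- w + w * z) powr (- a) / exp (- w + w * z)) \<partial>lborel)"
    by (subst nn_integral_real_affine[where t="- w" and c=w]) (use w in simp_all)
  also have "(\<lambda>z. ennreal (indicator {0..} (- w + w * z) * (- w + w * z) powr (- a) / exp (- w + w * z))) =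
    (\<lambda>z. ennreal (w powr (- a) * exp w) * ennreal (indicator {1..} z * (z - 1) powr (- a) * exp (- w * z)))"
  proof
    fix z
    have "- w + w * z = w * (z - 1)" by (simp add: algebra_simps)
    moreover have "(0 \<le> w * (z - 1)) = (1 \<le> z)" using w by (simp add: zero_le_mult_iff)
    moreover have "1 / exp (w * (z - 1)) = exp w * exp (- w * z)"
      by (simp add: exp_minus[symmetric] exp_add[symmetric] algebra_simps divide_inverse)
    ultimately show "ennreal (indicator {0..} (- w + w * z) * (- w + w * z) powr (- a) / exp (- w + w * z)) =
      ennreal (w powr (- a) * exp w) * ennreal (indicator {1..} z * (z - 1) powr (- a) * exp (- w * z))"
      using w by (auto simp: ennreal_mult[symmetric] powr_mult divide_inverse mult_ac split: split_indicator)
  qed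
  also have "(\<integral>\<^sup>+z. ennreal (w powr (- a) * exp w) * ennreal (indicator {1..} z * (z - 1) powr (- a) * exp (- w * z)) \<partial>lborel) =
    ennreal (w powr (- a) * exp w) * ?I"
    by (rule nn_integral_cmult) measurable
  finally have "ennreal c * ennreal (Gamma (1 - a)) = ennreal (c * (w * (w powr (- a) * exp w))) * ?I"
    using w c(1) by (simp add: ennreal_mult mult.assoc)
  then have "?I = ennreal (c * Gamma (1 - a))"
    unfolding c(2) using c(1) pos by (simp add: ennreal_mult)
  then show ?thesis by (simp add: c_def mult_ac)
qed

text \<open>Tonelli, with the inner integral over \<open>z\<close> given by
  \<open>nn_integral_shifted_gamma\<close>. Taking \<open>W = {0..x}\<close> and
  \<open>h z = 1 - exp (- z * x)\<close> yields \<open>phi\<close>, while \<open>W = {0..}\<close>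
  and \<open>h = 1\<close> yield the total mass.\<close>

lemma nn_integral_pi_density_mixture:
  assumes a: "0 < a" "a < 1" and [measurable]: "W \<in> sets borel" and W: "W \<subseteq> {0..}"
    and h[measurable]: "h \<in> borel_measurable borel"
    and h_eq: "\<And>z. 1 \<le> z \<Longrightarrow> (\<integral>\<^sup>+w. ennreal (exp (- w * z)) * indicator W w \<partial>lborel) = ennreal (h z / z)"
  shows "(\<integral>\<^sup>+z. ennreal (pi_density a z * h z) \<partial>lborel) =
    ennreal a * (\<integral>\<^sup>+w. ennreal (exp (- w) * w powr (a - 1)) * indicator W w \<partial>lborel)"
proof -
  have G: "0 < Gamma (1 - a)" using a by (simp add: Gamma_real_pos)
  \<comment> \<open>The density without its factor \<open>1 / z\<close>, which the assumption on
    \<open>h\<close> supplies.\<close>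
  define q where "q z = a / Gamma (1 - a) * (indicator {1..} z * (z - 1) powr (- a))" for z
  have [measurable]: "q \<in> borel_measurable borel" unfolding q_def by measurable
  have q: "0 \<le> q z" for z using a G by (simp add: q_def)
  have "(\<integral>\<^sup>+z. ennreal (pi_density a z * h z) \<partial>lborel) =
    (\<integral>\<^sup>+z. \<integral>\<^sup>+w. ennreal (q z) * (ennreal (exp (- w * z)) * indicator W w) \<partial>lborel \<partial>lborel)"
  proof (rule nn_integral_cong)
    fix z
    have "(\<integral>\<^sup>+w. ennreal (q z) * (ennreal (exp (- w * z)) * indicator W w) \<partial>lborel) =
      ennreal (q z) * (\<integral>\<^sup>+w. ennreal (exp (- w * z)) * indicator W w \<partial>lborel)"
      by (rule nn_integral_cmult) measurable
    also have "\<dots> = ennreal (pi_density a z * h z)"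
    proof (cases "1 \<le> z")
      case True
      then show ?thesis
        by (simp only: h_eq[OF True] ennreal_mult'[OF q, symmetric])
          (simp add: q_def pi_density_def divide_inverse mult_ac)
    qed (simp add: q_def pi_density_def)
    finally show "ennreal (pi_density a z * h z) =
      (\<integral>\<^sup>+w. ennreal (q z) * (ennreal (exp (- w * z)) * indicator W w) \<partial>lborel)" ..
  qed
  also have "\<dots> = (\<integral>\<^sup>+w. \<integral>\<^sup>+z. ennreal (q z) * (ennreal (exp (- w * z)) * indicator W w) \<partial>lborel \<partial>lborel)"
    by (rule lborel_pair.Fubini') measurable
  also have "\<dots> = (\<integral>\<^sup>+w. ennreal a * (ennreal (exp (- w) * w powr (a - 1)) * indicator W w) \<partial>lborel)"
    \<comment> \<open>The shifted gamma integral is available only for \<open>w > 0\<close>, so the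
      point 0 is discarded.\<close>
    using AE_lborel_singleton[of 0]
  proof (intro nn_integral_cong_AE, eventually_elim)
    fix w :: real assume "w \<noteq> 0"
    show "(\<integral>\<^sup>+z. ennreal (q z) * (ennreal (exp (- w * z)) * indicator W w) \<partial>lborel) =
      ennreal a * (ennreal (exp (- w) * w powr (a - 1)) * indicator W w)"
    proof (cases "w \<in> W")
      case True
      with W \<open>w \<noteq> 0\<close> have w: "0 < w" by force
      have "(\<integral>\<^sup>+z. ennreal (q z) * (ennreal (exp (- w * z)) * indicator W w) \<partial>lborel) =
        (\<integral>\<^sup>+z. ennreal (a / Gamma (1 - a)) *
          ennreal (indicator {1..} z * (z - 1) powr (- a) * exp (- w * z)) \<partial>lborel)"
        using True a G by (intro nn_integral_cong) (simp add: q_def ennreal_mult[symmetric] mult_ac)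
      also have "\<dots> = ennreal (a / Gamma (1 - a)) * ennreal (Gamma (1 - a) * w powr (a - 1) * exp (- w))"
        by (subst nn_integral_cmult) (simp_all only: nn_integral_shifted_gamma[OF a(2) w], measurable)
      also have "\<dots> = ennreal a * ennreal (exp (- w) * w powr (a - 1))"
        using a G less_imp_neq[OF G] by (simp add: ennreal_mult[symmetric])
      finally show ?thesis using True by simp
    qed simp
  qed
  also have "\<dots> = ennreal a * (\<integral>\<^sup>+w. ennreal (exp (- w) * w powr (a - 1)) * indicator W w \<partial>lborel)"
    by (rule nn_integral_cmult) measurable
  finally show ?thesis .
qed

lemma nn_integral_pi_density:
  assumes a: "0 < a" "a < 1"
  shows "(\<integral>\<^sup>+z. ennreal (pi_density a z) \<partial>lborel) = ennreal (a * Gamma a)"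
proof -
  have "(\<integral>\<^sup>+w. ennreal (exp (- w * z)) * indicator {0..} w \<partial>lborel) = ennreal (1 / z)" if z: "1 \<le> z" for z
  proof -
    have "((\<lambda>w. - exp (- w * z) / z) \<longlongrightarrow> 0) at_top"
      using z by real_asymp
    then have "(\<integral>\<^sup>+w. ennreal (exp (- w * z)) * indicator {0..} w \<partial>lborel) = ennreal (0 - (- exp (- 0 * z) / z))"
      using z by (intro nn_integral_FTC_atLeast) (auto intro!: derivative_eq_intros)
    then show ?thesis by simp
  qed
  then have "(\<integral>\<^sup>+z. ennreal (pi_density a z * 1) \<partial>lborel) =
    ennreal a * (\<integral>\<^sup>+w. ennreal (exp (- w) * w powr (a - 1)) * indicator {0..} w \<partial>lborel)"
    using a by (intro nn_integral_pi_density_mixture) auto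
  also have "(\<integral>\<^sup>+w. ennreal (exp (- w) * w powr (a - 1)) * indicator {0..} w \<partial>lborel) = ennreal (Gamma a)"
    using Gamma_conv_nn_integral_real[OF a(1)] a
    by (auto intro!: nn_integral_cong simp: exp_minus divide_inverse mult.commute split: split_indicator)
  finally show ?thesis using a by (simp add: ennreal_mult)
qed

section \<open>The incomplete gamma function as a Laplace exponent\<close>

lemma nn_integral_exp_Icc:
  assumes "0 < z" "0 \<le> x"
  shows "(\<integral>\<^sup>+w. ennreal (exp (- w * z)) * indicator {0..x} w \<partial>lborel) = ennreal ((1 - exp (- z * x)) / z)"
proof -
  have "(\<integral>\<^sup>+w. ennreal (exp (- w * z)) * indicator {0..x} w \<partial>lborel) =
    ennreal (- exp (- x * z) / z - (- exp (- 0 * z) / z))"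
    using assms by (intro nn_integral_FTC_Icc) (auto intro!: derivative_eq_intros)
  then show ?thesis by (simp add: diff_divide_distrib mult.commute)
qed

text \<open>The integrand is nonnegative, so no integrability is required: a divergent integral
  would give 0 on both sides.\<close>

lemma lower_gamma_eq_nn_integral:
  "lower_gamma a x = enn2real (\<integral>\<^sup>+w. ennreal (exp (- w) * w powr (a - 1)) * indicator {0..x} w \<partial>lborel)"
  unfolding lower_gamma_def set_lebesgue_integral_def
  by (subst integral_eq_nn_integral)
    (auto intro!: arg_cong[where f=enn2real] nn_integral_cong split: split_indicator)

lemma phi_1: "0 \<le> x \<Longrightarrow> phi 1 x = 1 - exp (- x)"
proof -
  assume x: "0 \<le> x"
  have "(\<integral>\<^sup>+w. ennreal (exp (- w) * w powr (1 - 1)) * indicator {0..x} w \<partial>lborel) =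
    (\<integral>\<^sup>+w. ennreal (exp (- w * 1)) * indicator {0..x} w \<partial>lborel)"
    \<comment> \<open>\<open>0 powr 0\<close> is 0, so the two integrands differ at
      \<open>w = 0\<close>.\<close>
    using AE_lborel_singleton[of 0] by (intro nn_integral_cong_AE, eventually_elim) simp
  also have "\<dots> = ennreal (1 - exp (- x))"
    using nn_integral_exp_Icc[of 1 x] x by simp
  finally show ?thesis
    using x by (simp only: phi_def lower_gamma_eq_nn_integral) simp
qed

lemma phi_eq_integral_pi_density:
  assumes a: "0 < a" "a < 1" and x: "0 \<le> x"
  shows "phi a x = (LINT z|lborel. pi_density a z * (1 - exp (- z * x)))"
proof -
  \<comment> \<open>For negative \<open>z\<close> the second factor can be negative, but the density
    vanishes below 1.\<close>
  have "0 \<le> pi_density a z * (1 - exp (- z * x))" for z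
  proof (cases "1 \<le> z")
    case True
    then show ?thesis using pi_density_nonneg[OF a] x by simp
  qed (simp add: pi_density_def)
  then have "(LINT z|lborel. pi_density a z * (1 - exp (- z * x))) =
    enn2real (\<integral>\<^sup>+z. ennreal (pi_density a z * (1 - exp (- z * x))) \<partial>lborel)"
    by (intro integral_eq_nn_integral) auto
  also have "(\<integral>\<^sup>+z. ennreal (pi_density a z * (1 - exp (- z * x))) \<partial>lborel) =
    ennreal a * (\<integral>\<^sup>+w. ennreal (exp (- w) * w powr (a - 1)) * indicator {0..x} w \<partial>lborel)"
    using a x by (intro nn_integral_pi_density_mixture) (auto simp: nn_integral_exp_Icc[simplified])
  finally show ?thesis
    using a by (simp add: phi_def lower_gamma_eq_nn_integral enn2real_mult)
qed

lemma levy_measure_of_finite_mass: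
  assumes "sets \<pi> = sets lborel_pos" "emeasure \<pi> {0<..} < \<infinity>"
  shows "levy_measure \<pi>"
proof -
  have "space \<pi> = {0<..}"
    using sets_eq_imp_space_eq[OF assms(1)] by (simp add: space_restrict_space)
  moreover have "(\<integral>\<^sup>+s. ennreal (min s 1) \<partial>\<pi>) \<le> (\<integral>\<^sup>+s. 1 \<partial>\<pi>)"
    by (intro nn_integral_mono) (simp add: ennreal_leI flip: ennreal_1)
  ultimately show ?thesis
    using assms by (simp add: levy_measure_def le_less_trans)
qed

lemma phi_integral_density:
  assumes a: "0 < a" "a < 1" and x: "0 \<le> x"
  shows "phi a x = (LINT s|density lborel_pos (\<lambda>z. ennreal (pi_density a z)). 1 - exp (- s * x))"
proof -
  have "(LINT s|density lborel_pos (\<lambda>z. ennreal (pi_density a z)). 1 - exp (- s * x)) =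
    (LINT s|lborel_pos. pi_density a s *\<^sub>R (1 - exp (- s * x)))"
    using pi_density_nonneg[OF a]
    by (intro integral_density) (auto intro!: measurable_restrict_space1)
  also have "\<dots> = (LINT s|lborel. indicator {0<..} s *\<^sub>R (pi_density a s *\<^sub>R (1 - exp (- s * x))))"
    by (rule integral_restrict_space) simp
  also have "\<dots> = (LINT s|lborel. pi_density a s * (1 - exp (- s * x)))"
    by (intro Bochner_Integration.integral_cong) (auto simp: pi_density_def split: split_indicator)
  finally show ?thesis using phi_eq_integral_pi_density[OF assms] by simp
qed

lemma emeasure_density_pi_density:
  assumes "0 < a" "a < 1"
  shows "emeasure (density lborel_pos (\<lambda>z. ennreal (pi_density a z))) {0<..} = ennreal (a * Gamma a)"
proof -
  have "emeasure (density lborel_pos (\<lambda>z. ennreal (pi_density a z))) {0<..} =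
    (\<integral>\<^sup>+z. ennreal (pi_density a z) * indicator {0<..} z \<partial>lborel_pos)"
    by (rule emeasure_density) (auto intro!: measurable_restrict_space1 simp: sets_restrict_space)
  also have "\<dots> = (\<integral>\<^sup>+z. ennreal (pi_density a z) * indicator {0<..} z * indicator {0<..} z \<partial>lborel)"
    by (rule nn_integral_restrict_space) simp
  also have "\<dots> = (\<integral>\<^sup>+z. ennreal (pi_density a z) \<partial>lborel)"
    by (intro nn_integral_cong) (auto simp: pi_density_def split: split_indicator)
  finally show ?thesis using nn_integral_pi_density[OF assms] by simp
qed

theorem theorem1:
  fixes \<alpha> :: real
  assumes "0 < \<alpha>" and "\<alpha> \<le> 1"
  shows "\<exists>(M :: (nat \<Rightarrow> real) measure) (S :: real \<Rightarrow> (nat \<Rightarrow> real) \<Rightarrow> real) (\<pi> :: real measure).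
           subordinator M S \<and>
           has_laplace_exponent M S (phi \<alpha>) \<and>
           levy_triplet (phi \<alpha>) 0 0 \<pi> \<and>
           finite_activity 0 0 \<pi> \<and>
           (\<alpha> < 1 \<longrightarrow>
              absolutely_continuous lborel_pos \<pi> \<and>
              \<pi> = density lborel_pos (\<lambda>z. ennreal (pi_density \<alpha> z)) \<and>
              completely_monotone_beyond 1 (pi_density \<alpha>)) \<and>
           (\<alpha> = 1 \<longrightarrow> \<pi> = return lborel_pos 1)"
proof -
  \<comment> \<open>At \<open>\<alpha> = 1\<close> the density formula degenerates to 0, while
    \<open>phi 1 \<eta> = 1 - exp (- \<eta>)\<close> is the exponent of a standard Poisson process,
    whose Levy measure is the unit mass at 1.\<close>
  define \<pi> where "\<pi> = (if \<alpha> < 1 then density lborel_pos (\<lambda>z. ennreal (pi_density \<alpha> z)) else return lborel_pos 1)"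
  have sets: "sets \<pi> = sets lborel_pos"
    by (simp add: \<pi>_def)
  \<comment> \<open>The mass is \<open>\<alpha> * Gamma \<alpha>\<close> for
    \<open>\<alpha> < 1\<close> and 1 otherwise; its positivity makes it a legitimate jump
    rate.\<close>
  obtain m where m: "0 < m" "emeasure \<pi> {0<..} = ennreal m"
  proof (cases "\<alpha> < 1")
    case True
    with assms show thesis
      by (intro that[of "\<alpha> * Gamma \<alpha>"]) (simp_all add: \<pi>_def emeasure_density_pi_density Gamma_real_pos)
  next
    case False
    have "{0<..} \<in> sets lborel_pos"
      using sets.top[of lborel_pos] by (simp add: space_restrict_space)
    with False show thesis
      by (intro that[of 1]) (simp_all add: \<pi>_def)
  qed
  have phi: "phi \<alpha> \<eta> = (LINT s|\<pi>. 1 - exp (- s * \<eta>))" if "0 \<le> \<eta>" for \<eta>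
  proof (cases "\<alpha> < 1")
    case True
    then show ?thesis using assms(1) that by (simp add: \<pi>_def phi_integral_density)
  next
    case False
    then have "(LINT s|\<pi>. 1 - exp (- s * \<eta>)) = 1 - exp (- 1 * \<eta>)"
      unfolding \<pi>_def
      by (simp only: if_False, intro integral_return) (auto intro!: measurable_restrict_space1 simp: space_restrict_space)
    with False assms(2) that show ?thesis by (simp add: phi_1)
  qed
  obtain M :: "(nat \<Rightarrow> real) measure" and S
    where MS: "subordinator M S" "has_laplace_exponent M S (\<lambda>\<eta>. LINT s|\<pi>. 1 - exp (- s * \<eta>))"
    using subordinator_of_finite_levy_measure[OF sets m(2,1)] .
  have "has_laplace_exponent M S (phi \<alpha>)"
    using MS(2) by (simp add: has_laplace_exponent_def phi)
  moreover have "levy_triplet (phi \<alpha>) 0 0 \<pi>"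
    using levy_measure_of_finite_mass[OF sets] m phi by (simp add: levy_triplet_def)
  moreover have "finite_activity 0 0 \<pi>"
    using m by (simp add: finite_activity_def)
  moreover have "absolutely_continuous lborel_pos \<pi> \<and>
      \<pi> = density lborel_pos (\<lambda>z. ennreal (pi_density \<alpha> z)) \<and>
      completely_monotone_beyond 1 (pi_density \<alpha>)" if "\<alpha> < 1"
    using that assms(1) completely_monotone_pi_density
    by (auto simp: \<pi>_def intro!: absolutely_continuousI_density measurable_restrict_space1)
  moreover have "\<alpha> = 1 \<longrightarrow> \<pi> = return lborel_pos 1"
    by (simp add: \<pi>_def)
  ultimately show ?thesis
    using MS(1) by blast
qed

end
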